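(* There exist learned-symmetric markets $\mathcal M,\widetilde{\mathcal M}$ (with endogenous prices) with transcribed sequential screening, identical except that $\widetilde{\mathcal M}$ is more consumer-informative, such that no businesses are ever lost in either market and $\widetilde{\mathcal M}$ has strictly lower canonical consumer welfare: $U(\widetilde{\mathcal M})<U(\mathcal M)$.
   Context: A market $\mathcal M$ with endogenous prices consists of: $m$ businesses $j\in[m]$ with parameters $\pi_j\in(0,1)$ (fit probability) and $Q_j\in[0,1]$ (quality); a value distribution $\mathcal D^V$ on $[0,\infty)$ that is regular (with CDF $\Psi$ and density $\psi$, $v-(1-\Psi(v))/\psi(v)$ is non-decreasing), has a density, and has bounded support with maximum $\overline V$; a common prior over the parameters; a search cost $c\ge 0$; and for each business a demand-responsive pricing rule. The parameters are fixed and are a potential realization of the prior (lie in its support). Transcribed sequential screening with search degree $k$: for each consumer $i$ and business $j$ there is a sequence of $r$ binary screens $f_{ij1},\dots,f_{ijr}$, possibly correlated within the sequence but drawn independently across consumers and businesses (identically across consumers), with $\pi_{j\ell}=\Pr[f_{ij\ell}=1\mid f_{ij1}=\dots=f_{ij,\ell-1}=1]$; fit $F_{ij}=\prod_{\ell\le k}f_{ij\ell}$, quality realization $q_{ij}=\prod_{\ell>k}f_{ij\ell}$, so $\pi_j=\prod_{\ell\le k}\pi_{j\ell}$, $Q_j=\prod_{\ell>k}\pi_{j\ell}$. The common prior is over the $\pi_{j\ell}$, independent across $j$ and $\ell$. Inspection reveals $F_{ij}$ and, if $F_{ij}=0$, the minimum $\ell\le k$ with $f_{ij\ell}=0$; post-transaction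 feedback reveals $q_{ij}$ and, if $q_{ij}=0$, the minimum $\ell>k$ with $f_{ij\ell}=0$. $\widetilde{\mathcal M}$ is more consumer-informative than $\mathcal M$ if the two are identical except that $\widetilde{\mathcal M}$ has a larger search degree $\tilde k\ge k$. Dynamics: in round $i=1,2,\dots$ each business sets a publicly observed price $P_{ij}\ge0$ as a (possibly randomized) function of the past history $H^{\mathcal M}_{i-1}$, and consumer $i$ arrives with value $V_i\sim\mathcal D^V$ (i.i.d.). She sequentially inspects businesses at cost $c$ each and transacts with at most one inspected business; transacting with $j$ gives expected utility $V_iQ_jF_{ij}-P_{ij}$ given $F_{ij}$; total utility subtracts search costs. The history records prices and all inspection and post-transaction signals. Let $\hat\pi_{ij},\hat Q_{ij}$ be the posterior means of $\pi_j,Q_j$ given $H^{\mathcal M}_{i-1}$ (no inference from prices) and $\sigma_j(P,\hat\pi,\hat Q,V)=V\hat Q-P-c/\hat\pi$. Optimal search: inspect businesses with $\sigma_j(P_{ij},\hat\pi_{ij},\hat Q_{ij},V_i)>0$ in decreasing order of index, transact with the first that fits. Demand-responsive: $P_{ij}$ is such that $\sigma_j(P_{ij},\hat\pi_{ij},\hat Q_{ij},\overline V)>0$ whenever some price $\ge0$ achieves this. Business $j$ is learned if the posteriors of $(\pi_j,Q_j)$ converge (in probability, as $i\to\infty$) to the true values; it is lost if $\sigma_j(0,\hat\pi_{ij},\hat Q_{ij},\overline V)\le0$ for some $i$ and all later ones. $S^{\mathrm{lnd}}(\mathcal M)$ is the random set of learned businesses. $\mathcal M$ is learned-symmetric if,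 almost surely over the realization $S$ of $S^{\mathrm{lnd}}(\mathcal M)$, $\pi_j=\pi_{j'}$, $Q_j=Q_{j'}$ for all $j,j'\in S$. A (steady-state) market equilibrium specifies limit beliefs and price distributions $(\Gamma_j)_{j\in[m]}$ such that (1) each business is either learned (beliefs are point masses at $(\pi_j,Q_j)$) or lost (index at price $0$ and value $\overline V$ is $\le0$); (2) for each $j$, fixing the others' price distributions, each price in the support of $\Gamma_j$ maximizes $j$'s expected revenue from a consumer with the limit beliefs and value drawn from $\mathcal D^V$ who searches optimally. It is symmetric if all learned businesses use the same price distribution. For a learned-symmetric market and realization $S$ of the learned set there is almost surely a unique symmetric market equilibrium with learned set $S$, denoted $\Phi(\mathcal M,S)$: with $n=|S|$, common type $(\pi,Q)$, $W=0$ with probability $1-\pi$ and $W=VQ-c/\pi$, $V\sim\mathcal D^V$, otherwise, $D(p)=\Pr[W>p]$, and $p^*$ a maximizer of $pD(p)$, each learned business draws its price from $[\underline p,p^*]$ with CDF $G(p)=\frac1\pi\bigl[1-(1-\pi)\bigl(\frac{p^*D(p^* )}{pD(p)}\bigr)^{1/(n-1)}\bigr]$, $\underline p$ being the maximum value with $G(\underline p)=0$ (for $n=1$, the business charges the monopoly price $p^*$). The canonical equilibrium is $\Phi_{\mathrm{can}}(\mathcal M)=\Phi(\mathcal M,S^{\mathrm{lnd}}(\mathcal M))$. Canonical consumer welfare $U(\mathcal M)$ is the expected total utility (net of price and search costs) of a consumer with the limit beliefs and value from $\mathcal D^V$, searching optimally when prices are drawn from $\Phi_{\mathrm{can}}(\mathcal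 M)$. *)

theory Defs
  imports "HOL-Probability.Probability"
begin

definition supp :: "'a::topological_space measure \<Rightarrow> 'a set" where
  "supp \<mu> = {x. \<forall>U. open U \<longrightarrow> x \<in> U \<longrightarrow> 0 < emeasure \<mu> U}"


section \<open>Markets\<close>

text \<open>Businesses are numbered \<open>0, \<dots>, m - 1\<close> and screens \<open>0, \<dots>, r - 1\<close>. With search degree
  \<open>k\<close>, the screens \<open>l < k\<close> determine the fit and the screens \<open>k \<le> l < r\<close> the quality.\<close>

text \<open>What is revealed about a block of screens: that all of them are passed, or the least index
  of a failed one.\<close>

datatype outcome = Pass | FailAt nat

text \<open>Public record of a round. \<open>inspected j\<close> is \<open>None\<close> if business \<open>j\<close> was not inspected;
  \<open>feedback j\<close> is \<open>None\<close> if there was no transaction with \<open>j\<close>.\<close>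

record entry =
  prices :: "nat \<Rightarrow> real"
  inspected :: "nat \<Rightarrow> outcome option"
  feedback :: "nat \<Rightarrow> outcome option"

text \<open>\<open>screen_law j\<close> is the joint law of the screens of business \<open>j\<close> for one consumer, and
  \<open>screen_param j l\<close> the conditional probability of passing screen \<open>l\<close> after passing all earlier
  ones. \<open>screen_prior j l\<close> is the prior of the latter. A pricing rule maps the history and a
  private random seed, uniform on \<open>[0, 1]\<close>, to a price; this represents an arbitrary price
  distribution for each history.\<close>

record market =
  num_businesses :: nat
  num_screens :: nat
  search_degree :: nat
  search_cost :: real
  value_density :: "real \<Rightarrow> real"
  screen_law :: "nat \<Rightarrow> bool list pmf"
  screen_param :: "nat \<Rightarrow> nat \<Rightarrow> real"
  screen_prior :: "nat \<Rightarrow> nat \<Rightarrow> real measure"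
  pricing_rule :: "nat \<Rightarrow> entry list \<Rightarrow> real \<Rightarrow> real"

abbreviation businesses :: "market \<Rightarrow> nat set" where
  "businesses M \<equiv> {..<num_businesses M}"

definition value_dist :: "market \<Rightarrow> real measure" where
  "value_dist M = density lborel (\<lambda>v. ennreal (value_density M v))"

definition max_value :: "market \<Rightarrow> real" where
  "max_value M = Sup (supp (value_dist M))"

text \<open>In the extended reals, \<open>(1 - \<Psi> v) / \<psi> v\<close> is \<open>\<infinity>\<close> where \<open>\<psi> v = 0\<close> and \<open>\<Psi> v < 1\<close>, so the
  virtual value is \<open>-\<infinity>\<close> there; in particular gaps in the support are excluded by regularity.\<close>

definition virtual_value :: "market \<Rightarrow> real \<Rightarrow> ereal" where
  "virtual_value M v =
     ereal v - ereal (1 - cdf (value_dist M) v) / ereal (value_density M v)"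

definition regular_values :: "market \<Rightarrow> bool" where
  "regular_values M \<longleftrightarrow> mono_on {0..} (virtual_value M)"

definition fit_prob :: "market \<Rightarrow> (nat \<Rightarrow> nat \<Rightarrow> real) \<Rightarrow> nat \<Rightarrow> real" where
  "fit_prob M \<theta> j = (\<Prod>l<search_degree M. \<theta> j l)"

definition quality :: "market \<Rightarrow> (nat \<Rightarrow> nat \<Rightarrow> real) \<Rightarrow> nat \<Rightarrow> real" where
  "quality M \<theta> j = (\<Prod>l=search_degree M..<num_screens M. \<theta> j l)"

abbreviation true_fit :: "market \<Rightarrow> nat \<Rightarrow> real" where
  "true_fit M \<equiv> fit_prob M (screen_param M)"

abbreviation true_quality :: "market \<Rightarrow> nat \<Rightarrow> real" where
  "true_quality M \<equiv> quality M (screen_param M)"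


section \<open>Beliefs\<close>

definition joint_prior :: "market \<Rightarrow> (nat \<Rightarrow> nat \<Rightarrow> real) measure" where
  "joint_prior M =
     (\<Pi>\<^sub>M j\<in>businesses M. \<Pi>\<^sub>M l\<in>{..<num_screens M}. screen_prior M j l)"

fun outcome_prob :: "(nat \<Rightarrow> real) \<Rightarrow> nat \<Rightarrow> nat \<Rightarrow> outcome \<Rightarrow> real" where
  "outcome_prob q a b Pass = (\<Prod>l=a..<b. q l)"
| "outcome_prob q a b (FailAt i) = (\<Prod>l=a..<i. q l) * (1 - q i)"

text \<open>Likelihood of the recorded signals. Which businesses are inspected depends only on public
  information, the consumer's value, tie-breaking and earlier signals of the same round, and
  contributes no factor depending on \<open>\<theta>\<close>; nothing is inferred from prices.\<close>

definition likelihood :: "market \<Rightarrow> entry list \<Rightarrow> (nat \<Rightarrow> nat \<Rightarrow> real) \<Rightarrow> real" where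
  "likelihood M h \<theta> = (\<Prod>e\<leftarrow>h. \<Prod>j\<in>businesses M.
     (case inspected e j of None \<Rightarrow> 1
        | Some s \<Rightarrow> outcome_prob (\<theta> j) 0 (search_degree M) s) *
     (case feedback e j of None \<Rightarrow> 1
        | Some s \<Rightarrow> outcome_prob (\<theta> j) (search_degree M) (num_screens M) s))"

text \<open>Bayes' rule (the normalizing integral is positive almost surely).\<close>

definition posterior :: "market \<Rightarrow> entry list \<Rightarrow> (nat \<Rightarrow> nat \<Rightarrow> real) measure" where
  "posterior M h = density (joint_prior M)
     (\<lambda>\<theta>. ennreal (likelihood M h \<theta> / (\<integral>\<theta>'. likelihood M h \<theta>' \<partial>joint_prior M)))"

definition belief :: "market \<Rightarrow> entry list \<Rightarrow> nat \<Rightarrow> (real \<times> real) measure" where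
  "belief M h j = distr (posterior M h) borel (\<lambda>\<theta>. (fit_prob M \<theta> j, quality M \<theta> j))"

definition mean_fit :: "(real \<times> real) measure \<Rightarrow> real" where
  "mean_fit b = (\<integral>z. fst z \<partial>b)"

definition mean_quality :: "(real \<times> real) measure \<Rightarrow> real" where
  "mean_quality b = (\<integral>z. snd z \<partial>b)"


section \<open>Consumer search\<close>

definition index :: "market \<Rightarrow> real \<Rightarrow> (real \<times> real) measure \<Rightarrow> real \<Rightarrow> real" where
  "index M P b v = v * mean_quality b - P - search_cost M / mean_fit b"

text \<open>\<open>i\<close> precedes \<open>j\<close> in decreasing order of the index \<open>s\<close>. Ties are broken by \<open>t\<close>, which will
  be i.i.d. uniform, i.e. uniformly at random (the last disjunct has probability 0).\<close>

definition precedes :: "(nat \<Rightarrow> real) \<Rightarrow> (nat \<Rightarrow> real) \<Rightarrow> nat \<Rightarrow> nat \<Rightarrow> bool" where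
  "precedes s t i j \<longleftrightarrow> s i > s j \<or> s i = s j \<and> (t i < t j \<or> t i = t j \<and> i < j)"

definition inspections ::
  "nat set \<Rightarrow> (nat \<Rightarrow> real) \<Rightarrow> (nat \<Rightarrow> real) \<Rightarrow> (nat \<Rightarrow> bool) \<Rightarrow> nat set" where
  "inspections C s t F =
     {j \<in> C. s j > 0 \<and> (\<forall>i\<in>C. s i > 0 \<longrightarrow> precedes s t i j \<longrightarrow> \<not> F i)}"

text \<open>This set has at most one element.\<close>

definition transactions ::
  "nat set \<Rightarrow> (nat \<Rightarrow> real) \<Rightarrow> (nat \<Rightarrow> real) \<Rightarrow> (nat \<Rightarrow> bool) \<Rightarrow> nat set" where
  "transactions C s t F = {j \<in> inspections C s t F. F j}"

definition fits :: "market \<Rightarrow> (nat \<Rightarrow> bool list) \<Rightarrow> nat \<Rightarrow> bool" where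
  "fits M f j \<longleftrightarrow> (\<forall>l<search_degree M. f j ! l)"

definition uniform01 :: "real measure" where
  "uniform01 = uniform_measure lborel {0..1}"

text \<open>A consumer: her value, her screens with each business, and the tie-breaking seeds.\<close>

type_synonym consumer = "real \<times> (nat \<Rightarrow> bool list) \<times> (nat \<Rightarrow> real)"

definition consumer_law :: "market \<Rightarrow> consumer measure" where
  "consumer_law M = value_dist M \<Otimes>\<^sub>M
     ((\<Pi>\<^sub>M j\<in>businesses M. measure_pmf (screen_law M j)) \<Otimes>\<^sub>M
      (\<Pi>\<^sub>M j\<in>businesses M. uniform01))"


section \<open>Dynamics\<close>

text \<open>The randomness of a round is a consumer together with the seeds of the pricing rules; rounds
  are i.i.d. and numbered from 0.\<close>

type_synonym path = "nat \<Rightarrow> consumer \<times> (nat \<Rightarrow> real)"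

definition process :: "market \<Rightarrow> path measure" where
  "process M = (\<Pi>\<^sub>M i\<in>UNIV. consumer_law M \<Otimes>\<^sub>M (\<Pi>\<^sub>M j\<in>businesses M. uniform01))"

definition observed :: "nat \<Rightarrow> nat \<Rightarrow> bool list \<Rightarrow> outcome" where
  "observed a b f = (if \<forall>l\<in>{a..<b}. f ! l then Pass
     else FailAt (LEAST l. l \<in> {a..<b} \<and> \<not> f ! l))"

fun play_round :: "market \<Rightarrow> entry list \<Rightarrow> consumer \<times> (nat \<Rightarrow> real) \<Rightarrow> entry" where
  "play_round M h ((v, f, t), z) =
     (let P = (\<lambda>j. pricing_rule M j h (z j));
          s = (\<lambda>j. index M (P j) (belief M h j) v);
          I = inspections (businesses M) s t (fits M f);
          T = transactions (businesses M) s t (fits M f)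
      in \<lparr> prices = P,
           inspected = (\<lambda>j. if j \<in> I then Some (observed 0 (search_degree M) (f j)) else None),
           feedback = (\<lambda>j. if j \<in> T
              then Some (observed (search_degree M) (num_screens M) (f j)) else None) \<rparr>)"

text \<open>The history preceding round \<open>i\<close>.\<close>

primrec history :: "market \<Rightarrow> path \<Rightarrow> nat \<Rightarrow> entry list" where
  "history M \<omega> 0 = []"
| "history M \<omega> (Suc i) = history M \<omega> i @ [play_round M (history M \<omega> i) (\<omega> i)]"

definition price :: "market \<Rightarrow> path \<Rightarrow> nat \<Rightarrow> nat \<Rightarrow> real" where
  "price M \<omega> i j = pricing_rule M j (history M \<omega> i) (snd (\<omega> i) j)"

definition belief_at :: "market \<Rightarrow> path \<Rightarrow> nat \<Rightarrow> nat \<Rightarrow> (real \<times> real) measure" where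
  "belief_at M \<omega> i j = belief M (history M \<omega> i) j"

definition demand_responsive :: "market \<Rightarrow> bool" where
  "demand_responsive M \<longleftrightarrow> (AE \<omega> in process M. \<forall>i. \<forall>j\<in>businesses M.
     (\<exists>P\<ge>0. index M P (belief_at M \<omega> i j) (max_value M) > 0) \<longrightarrow>
     index M (price M \<omega> i j) (belief_at M \<omega> i j) (max_value M) > 0)"

text \<open>The measurability condition on the prices constrains the pricing rules: as the other data
  of a history are discrete, it makes all quantities of the dynamics random variables.\<close>

definition is_market :: "market \<Rightarrow> bool" where
  "is_market M \<longleftrightarrow>
     search_degree M \<le> num_screens M \<and>
     search_cost M \<ge> 0 \<and>
     value_density M \<in> borel_measurable borel \<and>
     (\<forall>v. value_density M v \<ge> 0) \<and>
     prob_space (value_dist M) \<and>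
     (AE v in value_dist M. v \<ge> 0) \<and>
     bdd_above (supp (value_dist M)) \<and>
     regular_values M \<and>
     (\<forall>j\<in>businesses M.
        (\<forall>f\<in>set_pmf (screen_law M j). length f = num_screens M) \<and>
        (\<forall>l<num_screens M.
           0 \<le> screen_param M j l \<and> screen_param M j l \<le> 1 \<and>
           (measure_pmf.prob (screen_law M j) {f. \<forall>i<l. f ! i} > 0 \<longrightarrow>
              screen_param M j l = \<P>(f in measure_pmf (screen_law M j). f ! l \<bar> \<forall>i<l. f ! i)) \<and>
           prob_space (screen_prior M j l) \<and>
           sets (screen_prior M j l) = sets borel \<and>
           (AE x in screen_prior M j l. 0 \<le> x \<and> x \<le> 1) \<and>
           screen_param M j l \<in> supp (screen_prior M j l)) \<and>
        0 < true_fit M j \<and> true_fit M j < 1 \<and>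
        (AE \<theta> in joint_prior M. 0 < fit_prob M \<theta> j \<and> fit_prob M \<theta> j < 1) \<and>
        (\<forall>h z. pricing_rule M j h z \<ge> 0) \<and>
        (\<forall>i. (\<lambda>\<omega>. price M \<omega> i j) \<in> borel_measurable (process M))) \<and>
     demand_responsive M"

definition more_consumer_informative :: "market \<Rightarrow> market \<Rightarrow> bool" where
  "more_consumer_informative M' M \<longleftrightarrow>
     (\<exists>k'\<ge>search_degree M. M' = M\<lparr>search_degree := k'\<rparr>)"

definition learned :: "market \<Rightarrow> path \<Rightarrow> nat \<Rightarrow> bool" where
  "learned M \<omega> j \<longleftrightarrow> (\<forall>\<epsilon>>0.
     (\<lambda>i. measure (belief_at M \<omega> i j) {z. dist z (true_fit M j, true_quality M j) > \<epsilon>})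
       \<longlonglongrightarrow> 0)"

definition learned_set :: "market \<Rightarrow> path \<Rightarrow> nat set" where
  "learned_set M \<omega> = {j \<in> businesses M. learned M \<omega> j}"

definition lost_belief :: "market \<Rightarrow> (real \<times> real) measure \<Rightarrow> bool" where
  "lost_belief M b \<longleftrightarrow> index M 0 b (max_value M) \<le> 0"

definition lost :: "market \<Rightarrow> path \<Rightarrow> nat \<Rightarrow> bool" where
  "lost M \<omega> j \<longleftrightarrow> (\<exists>i. \<forall>i'\<ge>i. lost_belief M (belief_at M \<omega> i' j))"

definition no_business_lost :: "market \<Rightarrow> bool" where
  "no_business_lost M \<longleftrightarrow> (AE \<omega> in process M. \<forall>j\<in>businesses M. \<not> lost M \<omega> j)"

definition learned_symmetric :: "market \<Rightarrow> bool" where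
  "learned_symmetric M \<longleftrightarrow> (AE \<omega> in process M.
     \<forall>j\<in>learned_set M \<omega>. \<forall>j'\<in>learned_set M \<omega>.
       true_fit M j = true_fit M j' \<and> true_quality M j = true_quality M j')"


section \<open>Market equilibrium\<close>

definition learned_belief :: "market \<Rightarrow> nat \<Rightarrow> (real \<times> real) measure" where
  "learned_belief M j = return borel (true_fit M j, true_quality M j)"

text \<open>Expected revenue of \<open>j\<close> at price \<open>p\<close> under limit beliefs \<open>B\<close>, when the others' prices are
  drawn independently from \<open>\<Gamma>\<close>. Fits are drawn from the true law, which agrees with the beliefs
  for learned businesses; lost ones are never inspected.\<close>

definition revenue ::
  "market \<Rightarrow> (nat \<Rightarrow> (real \<times> real) measure) \<Rightarrow> (nat \<Rightarrow> real measure) \<Rightarrow> nat \<Rightarrow> real \<Rightarrow> real" where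
  "revenue M B \<Gamma> j p = (\<integral>(P, (v, f, t)).
     p * of_bool (j \<in> transactions (businesses M)
                       (\<lambda>i. index M ((P(j := p)) i) (B i) v) t (fits M f))
     \<partial>((\<Pi>\<^sub>M i\<in>businesses M. \<Gamma> i) \<Otimes>\<^sub>M consumer_law M))"

definition price_dist :: "real measure \<Rightarrow> bool" where
  "price_dist G \<longleftrightarrow> prob_space G \<and> sets G = sets borel \<and> (AE p in G. p \<ge> 0)"

text \<open>Limit beliefs \<open>B\<close> and price distributions \<open>\<Gamma>\<close> form an equilibrium in which the businesses
  in \<open>S\<close> are learned and all others are lost.\<close>

definition market_equilibrium ::
  "market \<Rightarrow> nat set \<Rightarrow> (nat \<Rightarrow> (real \<times> real) measure) \<Rightarrow> (nat \<Rightarrow> real measure) \<Rightarrow> bool" where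
  "market_equilibrium M S B \<Gamma> \<longleftrightarrow>
     S \<subseteq> businesses M \<and>
     (\<forall>j\<in>S. B j = learned_belief M j) \<and>
     (\<forall>j\<in>businesses M - S.
        prob_space (B j) \<and> sets (B j) = sets borel \<and>
        (AE (x, y) in B j. 0 < x \<and> x < 1 \<and> 0 \<le> y \<and> y \<le> 1) \<and>
        lost_belief M (B j)) \<and>
     (\<forall>j\<in>businesses M. price_dist (\<Gamma> j) \<and>
        (\<forall>p\<in>supp (\<Gamma> j). \<forall>p'\<ge>0. revenue M B \<Gamma> j p' \<le> revenue M B \<Gamma> j p))"

text \<open>The price distribution shared by the learned businesses in the symmetric equilibrium with
  learned set \<open>S\<close>. The equilibrium is unique only in this sense: lost businesses earn nothing
  whatever they charge, so their price distributions are arbitrary (and irrelevant).\<close>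

definition symmetric_price_dist :: "market \<Rightarrow> nat set \<Rightarrow> real measure" where
  "symmetric_price_dist M S =
     (THE G. \<exists>B \<Gamma>. market_equilibrium M S B \<Gamma> \<and> (\<forall>j\<in>S. \<Gamma> j = G))"

text \<open>Expected utility of a consumer when the businesses in \<open>S\<close> are learned and draw their prices
  independently from \<open>G\<close>, while the others are lost (hence not inspected).\<close>

definition consumer_welfare :: "market \<Rightarrow> nat set \<Rightarrow> real measure \<Rightarrow> real" where
  "consumer_welfare M S G = (\<integral>(P, (v, f, t)).
     (let s = (\<lambda>j. index M (P j) (learned_belief M j) v)
      in (\<Sum>j\<in>transactions S s t (fits M f). v * true_quality M j - P j)
           - search_cost M * real (card (inspections S s t (fits M f))))
     \<partial>((\<Pi>\<^sub>M j\<in>S. G) \<Otimes>\<^sub>M consumer_law M))"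

text \<open>The expectation is also over the random learned set.\<close>

definition canonical_welfare :: "market \<Rightarrow> real" where
  "canonical_welfare M =
     (\<integral>\<omega>. (let S = learned_set M \<omega> in consumer_welfare M S (symmetric_price_dist M S))
        \<partial>process M)"

end

theory Submission
  imports Defs
begin

text \<open>
  Two identical businesses compete without search costs, and the priors are point masses at the true
  parameters, so that all beliefs are correct from the start. Each business has two screens with
  passing probability \<open>1/2\<close>; only the first one determines the fit in \<open>M\<close>, but both do in \<open>M'\<close>. This
  lowers the fit probability \<open>\<pi>\<close> and raises the quality \<open>Q\<close> with \<open>\<pi> Q = 1/4\<close> fixed. Values are uniform
  on \<open>[1, 2]\<close>, which makes the monopoly price \<open>Q\<close> a price at which everybody buys. In equilibrium a
  business is indifferent between its price and serving, at price \<open>Q\<close>, the consumers that the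
  competitor does not fit, so the consumer pays \<open>2 \<pi> (1 - \<pi>) Q\<close> in expectation for a surplus of
  \<open>(3/2) Q (2 \<pi> - \<pi>\<^sup>2)\<close>. The difference \<open>\<pi> Q (1 + \<pi>/2)\<close> increases with \<open>\<pi>\<close>: rarer fits mean weaker
  competition, and this outweighs the larger surplus.
\<close>

section \<open>Supports and product measures\<close>

text \<open>A point outside the support has a null open neighbourhood and so lies in a null basic
  open set. By second countability the union \<open>N\<close> of all such basic sets is a countable
  one, hence null.\<close>

lemma AE_in_supp:
  fixes G :: "'a :: second_countable_topology measure"
  assumes [measurable_cong]: "sets G = sets borel"
  shows "AE x in G. x \<in> supp G"
proof -
  obtain B :: "'a set set" where B: "countable B" "topological_basis B"
    using ex_countable_basis by blast
  define N where "N = \<Union>{U \<in> B. emeasure G U = 0}"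
  have "N \<in> null_sets G"
    unfolding N_def
  proof (intro null_sets_UN'[where N="\<lambda>x. x", simplified])
    show "countable {U \<in> B. emeasure G U = 0}" using B(1) by auto
    show "U \<in> null_sets G" if "U \<in> {U \<in> B. emeasure G U = 0}" for U
      using that topological_basis_open[OF B(2)] assms by (auto simp: null_sets_def)
  qed
  moreover have "{x \<in> space G. x \<notin> supp G} \<subseteq> N"
  proof
    fix x assume "x \<in> {x \<in> space G. x \<notin> supp G}"
    then obtain U where U: "open U" "x \<in> U" "emeasure G U = 0" by (auto simp: supp_def)
    obtain V where V: "V \<in> B" "x \<in> V" "V \<subseteq> U" using topological_basisE[OF B(2) U(1,2)] by metis
    have "emeasure G V \<le> emeasure G U"
      by (rule emeasure_mono[OF V(3)]) (use U(1) assms in auto)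
    then show "x \<in> N" using U V by (auto simp: N_def)
  qed
  ultimately show ?thesis by (auto intro: AE_I')
qed

lemma closed_supp: "closed (supp G)"
proof -
  have "- supp G = \<Union>{U. open U \<and> emeasure G U = 0}"
    by (auto simp: supp_def)
  then have "open (- supp G)" by (metis (no_types, lifting) mem_Collect_eq open_Union)
  then show ?thesis by (simp add: closed_def)
qed

text \<open>The complement of \<open>C\<close> is an open null set, and such a set contains no point
  of the support.\<close>

lemma supp_subset_closed:
  assumes "closed C" "AE x in G. x \<in> C" "sets G = sets borel"
  shows "supp G \<subseteq> C"
proof
  fix x assume x: "x \<in> supp G"
  have "emeasure G (- C) = 0"
  proof (rule AE_iff_measurable[THEN iffD1, OF _ _ assms(2)])
    show "- C \<in> sets G" using assms by auto
    show "{x \<in> space G. x \<notin> C} = - C" using sets_eq_imp_space_eq[OF assms(3)] by auto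
  qed
  then show "x \<in> C" using x assms(1) by (force simp: supp_def open_Compl)
qed

lemma prob_space_uniform01: "prob_space uniform01"
  unfolding uniform01_def by (rule prob_space_uniform_measure) auto

lemma sets_uniform01 [measurable_cong, simp]: "sets uniform01 = sets borel"
  by (simp add: uniform01_def)

lemma AE_uniform01: "AE u in uniform01. u \<in> {0..1}"
  unfolding uniform01_def by (rule AE_uniform_measureI) auto

section \<open>Null sets and expectations on product spaces\<close>

lemma AE_pair_fst:
  assumes "prob_space N" "AE x in M. Q x"
  shows "AE z in M \<Otimes>\<^sub>M N. Q (fst z)"
proof (rule AE_distrD[OF measurable_fst])
  show "AE x in distr (M \<Otimes>\<^sub>M N) M fst. Q x"
    unfolding prob_space.distr_pair_fst[OF assms(1)] by (rule assms(2))
qed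

lemma AE_pair_snd:
  assumes "sigma_finite_measure N" "AE y in N. Q y"
  shows "AE z in M \<Otimes>\<^sub>M N. Q (snd z)"
proof -
  interpret N: sigma_finite_measure N by fact
  obtain A where A: "{y \<in> space N. \<not> Q y} \<subseteq> A" "emeasure N A = 0" "A \<in> sets N"
    using AE_E[OF assms(2)] by blast
  show ?thesis
  proof (rule AE_I[where N="space M \<times> A"])
    show "{z \<in> space (M \<Otimes>\<^sub>M N). \<not> Q (snd z)} \<subseteq> space M \<times> A"
      using A(1) by (auto simp: space_pair_measure)
    show "emeasure (M \<Otimes>\<^sub>M N) (space M \<times> A) = 0" "space M \<times> A \<in> sets (M \<Otimes>\<^sub>M N)"
      using A by (simp_all add: N.emeasure_pair_measure_Times)
  qed
qed

text \<open>Fubini for a factored integrand. \<open>has_bochner_integral\<close> carries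
  integrability and value together, so that the expectations further down can be assembled by
  introduction rules.\<close>

lemma has_bochner_integral_pair_mult:
  fixes f :: "'a \<Rightarrow> real" and g :: "'b \<Rightarrow> real"
  assumes "sigma_finite_measure M" "sigma_finite_measure N"
    and f: "has_bochner_integral M f a" and g: "has_bochner_integral N g b"
  shows "has_bochner_integral (M \<Otimes>\<^sub>M N) (\<lambda>z. f (fst z) * g (snd z)) (a * b)"
proof -
  interpret M: sigma_finite_measure M by fact
  interpret N: sigma_finite_measure N by fact
  interpret pair_sigma_finite M N ..
  have [measurable]: "f \<in> borel_measurable M" "g \<in> borel_measurable N"
    using f g by (auto dest: has_bochner_integral_integrable)
  have i: "integrable M f" "integrable N g" using f g by (auto simp: has_bochner_integral_iff)
  have int: "integrable (M \<Otimes>\<^sub>M N) (\<lambda>z. f (fst z) * g (snd z))"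
    by (rule Fubini_integrable) (use i in \<open>auto simp: abs_mult\<close>)
  have "integral\<^sup>L (M \<Otimes>\<^sub>M N) (\<lambda>z. f (fst z) * g (snd z)) = a * b"
    using f g by (subst integral_fst'[OF int, symmetric]) (simp add: has_bochner_integral_iff)
  then show ?thesis using int by (simp add: has_bochner_integral_iff)
qed

lemma has_bochner_integral_const:
  "prob_space M \<Longrightarrow> has_bochner_integral M (\<lambda>_. c :: real) c"
  by (simp add: has_bochner_integral_iff prob_space.prob_space finite_measure.integrable_const
      prob_space.finite_measure)

lemma prob_space_imp_product_sigma_finite:
  "prob_space N \<Longrightarrow> product_sigma_finite (\<lambda>_. N)"
  by (simp add: product_sigma_finite_def prob_space_imp_sigma_finite)

lemma has_bochner_integral_PiM_two:
  fixes f g :: "'a \<Rightarrow> real" and i j :: nat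
  assumes N: "prob_space N" and f: "has_bochner_integral N f a" and g: "has_bochner_integral N g b"
    and ij: "i < 2" "j < 2" "i \<noteq> j"
  shows "has_bochner_integral (\<Pi>\<^sub>M _\<in>{..<2}. N) (\<lambda>x. f (x i) * g (x j)) (a * b)"
proof -
  interpret product_sigma_finite "\<lambda>_ :: nat. N" using prob_space_imp_product_sigma_finite[OF N] .
  define h where "h l = (if l = i then f else g)" for l
  have h: "integrable N (h l)" for l
    using f g by (auto simp: h_def has_bochner_integral_iff)
  have ins: "{..<2} = {i, j}" using ij by auto
  show ?thesis
    using product_integrable_prod[of "{..<2}" h] product_integral_prod[of "{..<2}" h] h f g ij
    by (simp add: ins has_bochner_integral_iff h_def)
qed

lemma has_bochner_integral_PiM_one:
  fixes f :: "'a \<Rightarrow> real" and i :: nat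
  assumes "prob_space N" "has_bochner_integral N f a" "i < 2"
  shows "has_bochner_integral (\<Pi>\<^sub>M _\<in>{..<2}. N) (\<lambda>x. f (x i)) a"
proof -
  \<comment> \<open>The other coordinate is \<open>1 - i\<close>; it receives the constant factor
    1.\<close>
  have "1 - i < 2" "i \<noteq> 1 - i" using assms(3) by presburger+
  then show ?thesis
    using has_bochner_integral_PiM_two[OF assms(1,2) has_bochner_integral_const[OF assms(1), of 1]
        assms(3), of "1 - i"]
    by (simp del: One_nat_def)
qed

text \<open>Here the integrand need not factor. This form is for averaging over the competitor's
  price while one's own price is held fixed.\<close>

lemma integral_PiM_two:
  fixes \<phi> :: "'a \<Rightarrow> 'a \<Rightarrow> real" and i j :: nat
  assumes N: "prob_space N" and int: "integrable (\<Pi>\<^sub>M _\<in>{..<2}. N) (\<lambda>x. \<phi> (x i) (x j))"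
    and [measurable]: "case_prod \<phi> \<in> borel_measurable (N \<Otimes>\<^sub>M N)"
    and ij: "i < 2" "j < 2" "i \<noteq> j"
  shows "(\<integral>x. \<phi> (x i) (x j) \<partial>(\<Pi>\<^sub>M _\<in>{..<2}. N)) = (\<integral>x. \<integral>y. \<phi> x y \<partial>N \<partial>N)"
proof -
  interpret product_sigma_finite "\<lambda>_ :: nat. N" using prob_space_imp_product_sigma_finite[OF N] .
  interpret N: prob_space N by fact
  have ins: "{..<2} = insert j {i}" using ij by auto
  have "(\<integral>x. \<phi> (x i) (x j) \<partial>(\<Pi>\<^sub>M _\<in>{..<2}. N)) =
      (\<integral>x. \<integral>y. \<phi> (x i) y \<partial>N \<partial>(\<Pi>\<^sub>M _\<in>{i}. N))"
    using int ij unfolding ins by (subst product_integral_insert) auto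
  also have "\<dots> = (\<integral>x. \<integral>y. \<phi> x y \<partial>N \<partial>N)"
    by (subst product_integral_singleton[where f="\<lambda>x. \<integral>y. \<phi> x y \<partial>N" and i=i]) auto
  finally show ?thesis .
qed

lemma measurable_coordinate:
  "i < 2 \<Longrightarrow> sets N = sets borel \<Longrightarrow> (\<lambda>x. x i) \<in> borel_measurable (\<Pi>\<^sub>M _\<in>{..<2::nat}. N)"
  using measurable_component_singleton[of i "{..<2}" "\<lambda>_. N"] measurable_cong_sets[of _ _ N borel]
  by auto

text \<open>No business precedes itself, so the only one that can keep a willing consumer away from
  \<open>j\<close> is the competitor \<open>i\<close>.\<close>

lemma transactions_two:
  assumes "i < 2" "j < 2" "i \<noteq> j"
  shows "j \<in> transactions {..<2} s t F \<longleftrightarrow>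
    F j \<and> 0 < s j \<and> \<not> (0 < s i \<and> precedes s t i j \<and> F i)"
proof -
  have "{..<2} = {i, j}" using assms by auto
  then show ?thesis using assms by (auto simp: transactions_def inspections_def precedes_def)
qed

section \<open>Price competition between two businesses\<close>

locale duopoly =
  fixes \<pi> Q :: real
  assumes pi: "0 < \<pi>" "\<pi> < 1" and Q: "0 < Q"
begin

text \<open>For a value \<open>V\<close> uniform on [1, 2], the probability of
  \<open>V * Q > p\<close> is \<open>2 - p / Q\<close>, truncated to [0, 1].\<close>

definition demand :: "real \<Rightarrow> real" where
  "demand p = min 1 (max 0 (2 - p / Q))"

lemma demand_bounds: "0 \<le> demand p" "demand p \<le> 1"
  by (auto simp: demand_def)

lemma demand_antimono: "p \<le> q \<Longrightarrow> demand q \<le> demand p"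
  using divide_right_mono[of p q Q] Q by (auto simp: demand_def)

lemma demand_eq_1: "p \<le> Q \<Longrightarrow> demand p = 1"
  using Q by (auto simp: demand_def field_simps)

text \<open>\<open>Q\<close> is the unique monopoly price. Below it everybody buys and the revenue
  per fitting consumer is the price itself; above it the inequality amounts to the square of
  \<open>p - Q\<close> being positive.\<close>

lemma mult_demand_less:
  assumes "0 \<le> p" "p \<noteq> Q" shows "p * demand p < Q"
proof (cases "p < Q")
  case True
  then show ?thesis by (simp add: demand_eq_1)
next
  case False
  then have p: "Q < p" using assms by auto
  have "0 < (p - Q)\<^sup>2" using p by simp
  then have "p * (2 - p / Q) < Q" using Q by (simp add: field_simps power2_eq_square)
  moreover have "2 - p / Q < 1" using p Q by (simp add: field_simps)
  ultimately show ?thesis using Q by (auto simp: demand_def max_def min_def)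
qed

lemma mult_demand_le: "0 \<le> p \<Longrightarrow> p * demand p \<le> Q"
  using mult_demand_less[of p] demand_eq_1[of Q] by (cases "p = Q") auto

text \<open>\<open>\<tau>\<close> is the probability that a tie is broken in favour of the competitor.\<close>

definition profit :: "real \<Rightarrow> real measure \<Rightarrow> real \<Rightarrow> real" where
  "profit \<tau> G p = \<pi> * (p * demand p) * (1 - \<pi> * (measure G {..<p} + \<tau> * measure G {p}))"

text \<open>The solution \<open>F\<close> of the indifference equation
  \<open>p * (1 - \<pi> * F) = (1 - \<pi>) * Q\<close>, cut off at 0 below the lowest price
  \<open>(1 - \<pi>) * Q\<close>. This is the canonical CDF for two businesses with monopoly price
  \<open>Q\<close>.\<close>

definition equilibrium_cdf :: "real \<Rightarrow> real" where
  "equilibrium_cdf p =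
     (if p \<le> 0 then 0 else if Q \<le> p then 1 else max 0 ((1 - (1 - \<pi>) * Q / p) / \<pi>))"

section \<open>Necessity: an equilibrium price distribution has the CDF
  \<open>equilibrium_cdf\<close>\<close>

context
  fixes G :: "real measure" and \<tau> :: real
  assumes G: "price_dist G"
    and \<tau>: "0 < \<tau>" "\<tau> \<le> 1"
    and optimal: "\<And>p p'. p \<in> supp G \<Longrightarrow> 0 \<le> p' \<Longrightarrow> profit \<tau> G p' \<le> profit \<tau> G p"
begin

interpretation real_distribution G
  using G by (intro real_distribution.intro real_distribution_axioms.intro)
    (auto simp: price_dist_def)

lemma supp_nonneg: "supp G \<subseteq> {0..}"
  using G by (intro supp_subset_closed) (auto simp: price_dist_def)

text \<open>At price \<open>Q\<close> a business sells at least to all consumers whom it fits and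
  the competitor does not, however the competitor prices.\<close>

lemma profit_ge:
  assumes "p \<in> supp G" shows "\<pi> * Q * (1 - \<pi>) \<le> profit \<tau> G p"
proof -
  have "prob {..<Q} + \<tau> * prob {Q} \<le> prob {..<Q} + prob {Q}"
    using \<tau> by (simp add: mult_left_le_one_le)
  also have "\<dots> = prob ({..<Q} \<union> {Q})" by (rule finite_measure_Union[symmetric]) auto
  also have "\<dots> \<le> 1" by simp
  finally have "\<pi> * (prob {..<Q} + \<tau> * prob {Q}) \<le> \<pi>" using pi by (simp add: mult_left_le)
  then have "\<pi> * Q * (1 - \<pi>) \<le> profit \<tau> G Q"
    using pi Q by (simp add: profit_def demand_eq_1)
  also have "\<dots> \<le> profit \<tau> G p" using optimal[OF assms] Q by auto
  finally show ?thesis .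
qed

lemma profit_pos: "p \<in> supp G \<Longrightarrow> 0 < profit \<tau> G p"
  using profit_ge[of p] pi Q by (smt (verit) mult_pos_pos)

lemma supp_pos:
  assumes "p \<in> supp G" shows "0 < p" "0 < demand p"
proof -
  have "0 \<le> p" "p \<noteq> 0" "demand p \<noteq> 0"
    using supp_nonneg assms profit_pos[OF assms] by (auto simp: profit_def)
  then show "0 < p" "0 < demand p" using demand_bounds(1)[of p] by auto
qed

text \<open>Undercutting an atom by an arbitrarily small amount would be profitable.\<close>

lemma no_atoms: "prob {p} = 0"
proof (rule ccontr)
  assume neq: "prob {p} \<noteq> 0"
  then have atom: "0 < prob {p}" using measure_nonneg[of G "{p}"] by linarith
  have "p \<in> supp G" unfolding supp_def
  proof (intro CollectI allI impI)
    fix U assume "open U" "p \<in> U"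
    then have "prob {p} \<le> prob U" by (intro finite_measure_mono) auto
    then show "0 < emeasure G U" using atom by (simp add: emeasure_eq_measure)
  qed
  note p = this supp_pos[OF this]
  \<comment> \<open>\<open>A\<close> bounds from below the sales per fitting consumer just under
    \<open>p\<close>, and \<open>B\<close> is their level at \<open>p\<close>. The share
    \<open>\<tau>\<close> of the atom is lost only in \<open>B\<close>.\<close>
  define A where "A = demand p * (1 - \<pi> * prob {..<p})"
  define B where "B = demand p * (1 - \<pi> * (prob {..<p} + \<tau> * prob {p}))"
  have "p * A \<le> p * B"
  proof (rule field_le_mult_one_interval)
    fix z :: real assume z: "0 < z" "z < 1"
    \<comment> \<open>The undercutting price. As \<open>z < 1\<close> is arbitrary, the loss from
      the lower price vanishes and \<open>A\<close> and \<open>B\<close> are compared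
      directly.\<close>
    define p' where "p' = z * p"
    have p': "0 < p'" "p' < p" using z p by (auto simp: p'_def)
    have "prob {..<p'} + \<tau> * prob {p'} \<le> prob {..<p'} + prob {p'}"
      using \<tau> by (simp add: mult_left_le_one_le)
    also have "\<dots> = prob ({..<p'} \<union> {p'})" by (rule finite_measure_Union[symmetric]) auto
    also have "\<dots> \<le> prob {..<p}" using p' by (intro finite_measure_mono) auto
    finally have le: "prob {..<p'} + \<tau> * prob {p'} \<le> prob {..<p}" .
    have "\<pi> * prob {..<p} \<le> 1" using pi by (smt (verit) mult_le_one prob_le_1 measure_nonneg)
    then have "\<pi> * (p' * demand p) * (1 - \<pi> * prob {..<p}) \<le> profit \<tau> G p'"
      unfolding profit_def using pi p' p le demand_antimono[of p' p]
      by (intro mult_mono mult_left_mono) auto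
    also have "\<dots> \<le> profit \<tau> G p" using optimal[OF p(1)] p' by auto
    finally have "\<pi> * (z * (p * A)) \<le> \<pi> * (p * B)"
      by (simp add: profit_def A_def B_def p'_def algebra_simps)
    then show "z * (p * A) \<le> p * B" using pi by simp
  qed
  then have "A \<le> B" using p by simp
  moreover have "0 < demand p * (\<pi> * (\<tau> * prob {p}))" using pi \<tau> atom p by simp
  ultimately show False using p by (simp add: A_def B_def algebra_simps)
qed

lemma profit_eq: "profit \<tau> G p = \<pi> * (p * demand p) * (1 - \<pi> * cdf G p)"
proof -
  have "cdf G p = prob ({..<p} \<union> {p})" unfolding cdf_def by (rule arg_cong[where f=prob]) auto
  also have "\<dots> = prob {..<p}" by (subst finite_measure_Union) (auto simp: no_atoms)
  finally show ?thesis by (simp add: profit_def no_atoms)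
qed

lemma AE_supp: "AE x in G. x \<in> supp G"
  by (rule AE_in_supp) simp

text \<open>The competitor almost surely charges at most the largest price \<open>b\<close> of the
  support, so at \<open>b\<close> a business sells only to consumers whom the competitor does not
  fit. To earn what \<open>profit_ge\<close> guarantees, \<open>b * demand b\<close> must reach
  \<open>Q\<close>, which forces \<open>b = Q\<close>.\<close>

lemma Q_in_supp: "Q \<in> supp G" and supp_le_Q: "supp G \<subseteq> {..Q}"
proof -
  have ne: "supp G \<noteq> {}"
    using AE_supp by (auto simp: AE_False)
  \<comment> \<open>Demand vanishes above \<open>2 * Q\<close>, but prices in the support earn a
    positive profit. So the support is bounded and, being closed, contains its supremum.\<close>
  have "p \<le> 2 * Q" if "p \<in> supp G" for p
  proof -
    have "0 < 2 - p / Q" using supp_pos[OF that] by (simp add: demand_def)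
    then show ?thesis using Q by (simp add: field_simps)
  qed
  then have bdd: "bdd_above (supp G)" by (rule bdd_aboveI)
  define b where "b = Sup (supp G)"
  have b: "b \<in> supp G" unfolding b_def by (rule closed_contains_Sup[OF ne bdd closed_supp])
  have le: "x \<le> b" if "x \<in> supp G" for x unfolding b_def by (rule cSup_upper[OF that bdd])
  have "AE x in G. x \<in> {..b}" using AE_supp le by (auto elim!: eventually_mono)
  then have "cdf G b = 1" unfolding cdf_def by (subst prob_eq_1) auto
  then have "\<pi> * Q * (1 - \<pi>) \<le> \<pi> * (b * demand b) * (1 - \<pi>)"
    using profit_ge[OF b] by (simp add: profit_eq)
  then have "Q \<le> b * demand b" using pi by simp
  then have "b = Q" using mult_demand_less[of b] supp_pos[OF b] by force
  then show "Q \<in> supp G" "supp G \<subseteq> {..Q}" using b le by auto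
qed

lemma cdf_Q: "Q \<le> p \<Longrightarrow> cdf G p = 1"
  unfolding cdf_def using AE_supp supp_le_Q by (subst prob_eq_1) (auto elim!: eventually_mono)

text \<open>Both \<open>p\<close> and \<open>Q\<close> lie in the support, hence both are optimal
  and earn the same; at \<open>Q\<close> the CDF is 1.\<close>

lemma indifference:
  assumes "p \<in> supp G" shows "p * (1 - \<pi> * cdf G p) = Q * (1 - \<pi>)"
proof -
  have "profit \<tau> G p = profit \<tau> G Q"
    using optimal[OF assms, of Q] optimal[OF Q_in_supp, of p] Q supp_nonneg assms by fastforce
  moreover have "p \<le> Q" using supp_le_Q assms by auto
  ultimately show ?thesis using pi by (simp add: profit_eq demand_eq_1 cdf_Q)
qed

lemma cdf_eq_equilibrium_cdf: "cdf G p = equilibrium_cdf p"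
proof -
  consider "p \<le> 0" | "Q \<le> p" | "0 < p" "p < Q" by linarith
  then show ?thesis
  proof cases
    case 1
    have "AE x in G. x \<notin> {..p}" using AE_supp by (rule eventually_mono) (use 1 supp_pos in force)
    then have "cdf G p = 0" unfolding cdf_def by (subst prob_eq_0) auto
    then show ?thesis using 1 by (simp add: equilibrium_cdf_def)
  next
    case 2
    then show ?thesis using Q by (simp add: equilibrium_cdf_def cdf_Q)
  next
    case 3
    define g where "g = (1 - (1 - \<pi>) * Q / p) / \<pi>"
    \<comment> \<open>A deviation to \<open>p\<close> earns no more than the price \<open>Q\<close>
      does; this yields \<open>g \<le> cdf G p\<close>.\<close>
    have "\<pi> * (p * (1 - \<pi> * cdf G p)) \<le> \<pi> * (Q * (1 - \<pi>))"
      using optimal[OF Q_in_supp, of p] 3 by (simp add: profit_eq demand_eq_1 cdf_Q)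
    then have le: "p * (1 - \<pi> * cdf G p) \<le> Q * (1 - \<pi>)" using pi by simp
    \<comment> \<open>For the reverse bound, let \<open>a\<close> be the largest price of the
      support that is at most \<open>p\<close>. The CDF agrees at \<open>a\<close> and
      \<open>p\<close>, and indifference at \<open>a\<close> combined with \<open>a \<le> p\<close>
      gives the inequality. If there is no such price, the CDF is 0 at \<open>p\<close>.\<close>
    have "cdf G p = 0 \<or> Q * (1 - \<pi>) \<le> p * (1 - \<pi> * cdf G p)"
    proof (cases "supp G \<inter> {..p} = {}")
      case True
      have "AE x in G. x \<notin> {..p}" using AE_supp by (rule eventually_mono) (use True in auto)
      then have "cdf G p = 0" unfolding cdf_def by (subst prob_eq_0) auto
      then show ?thesis ..
    next
      case False
      define a where "a = Sup (supp G \<inter> {..p})"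
      have bdd: "bdd_above (supp G \<inter> {..p})" by (auto intro: bdd_aboveI)
      have "a \<in> supp G \<inter> {..p}" unfolding a_def
        by (rule closed_contains_Sup[OF False bdd]) (auto intro: closed_supp)
      then have a: "a \<in> supp G" "a \<le> p" by auto
      have "x \<le> a" if "x \<in> supp G" "x \<le> p" for x
        unfolding a_def using that by (intro cSup_upper[OF _ bdd]) auto
      then have "AE x in G. x \<in> {..p} \<longleftrightarrow> x \<in> {..a}"
        using AE_supp a by (auto elim!: eventually_mono)
      then have eq: "cdf G p = cdf G a" unfolding cdf_def by (intro finite_measure_eq_AE) auto
      have "\<pi> * cdf G a \<le> 1" using pi
        by (smt (verit) mult_le_one cdf_bounded_prob cdf_nonneg)
      then have "Q * (1 - \<pi>) \<le> p * (1 - \<pi> * cdf G a)"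
        unfolding indifference[OF a(1), symmetric] using a by (intro mult_right_mono) auto
      then show ?thesis by (simp add: eq)
    qed
    moreover have "g \<le> cdf G p" using le pi 3 by (simp add: g_def field_simps)
    moreover have "cdf G p \<le> g" if "Q * (1 - \<pi>) \<le> p * (1 - \<pi> * cdf G p)"
      using that pi 3 by (simp add: g_def field_simps)
    ultimately have "cdf G p = max 0 g" using cdf_nonneg[of p] by fastforce
    then show ?thesis using 3 by (simp add: equilibrium_cdf_def g_def)
  qed
qed

end

section \<open>Existence: an explicit distribution with this CDF is optimal against itself\<close>

definition equilibrium_price :: "real \<Rightarrow> real" where
  "equilibrium_price u = (1 - \<pi>) * Q / (1 - \<pi> * u)"

text \<open>\<open>equilibrium_price\<close> is the quantile function: it solves
  \<open>p * (1 - \<pi> * u) = (1 - \<pi>) * Q\<close> for \<open>p\<close>. Questions about prices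
  thus become questions about the uniform seed \<open>u\<close>.\<close>

definition equilibrium_dist :: "real measure" where
  "equilibrium_dist = distr uniform01 borel equilibrium_price"

lemma equilibrium_price_measurable [measurable]: "equilibrium_price \<in> borel_measurable borel"
  unfolding equilibrium_price_def by measurable

lemma real_distribution_equilibrium_dist: "real_distribution equilibrium_dist"
proof -
  interpret prob_space uniform01 by (rule prob_space_uniform01)
  show ?thesis unfolding equilibrium_dist_def
    by (intro real_distribution.intro real_distribution_axioms.intro prob_space_distr) auto
qed

lemma denominator_pos: "u \<in> {0..1} \<Longrightarrow> 0 < 1 - \<pi> * u"
  using pi by (smt (verit) atLeastAtMost_iff mult_left_le_one_le mult_left_le)

lemma equilibrium_price_bounds:
  "u \<in> {0..1} \<Longrightarrow> equilibrium_price u \<in> {(1 - \<pi>) * Q..Q}"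
  using denominator_pos[of u] mult_right_mono[of \<pi> 1 u] mult_left_mono[of u 1 \<pi>] pi Q
  by (auto simp: equilibrium_price_def field_simps)

lemma cdf_equilibrium_dist: "cdf equilibrium_dist p = equilibrium_cdf p"
proof -
  interpret U: prob_space uniform01 by (rule prob_space_uniform01)
  have "cdf equilibrium_dist p = U.prob {u. equilibrium_price u \<le> p}"
    unfolding cdf_def equilibrium_dist_def
    by (subst measure_distr) (auto simp: vimage_def sets_eq_imp_space_eq[OF sets_uniform01])
  also have "\<dots> = equilibrium_cdf p"
  proof -
    consider "p \<le> 0" | "Q \<le> p" | "0 < p" "p < Q" by linarith
    then show ?thesis
    proof cases
      case 1
      have "AE u in uniform01. u \<notin> {u. equilibrium_price u \<le> p}"
        using AE_uniform01
      proof (rule eventually_mono)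
        fix u :: real assume "u \<in> {0..1}"
        from equilibrium_price_bounds[OF this] show "u \<notin> {u. equilibrium_price u \<le> p}"
          using 1 mult_pos_pos[of "1 - \<pi>" Q] pi Q by (simp del: mult_pos_pos)
      qed
      then have "U.prob {u. equilibrium_price u \<le> p} = 0" by (subst U.prob_eq_0) auto
      then show ?thesis using 1 by (simp add: equilibrium_cdf_def)
    next
      case 2
      have "AE u in uniform01. u \<in> {u. equilibrium_price u \<le> p}"
        using AE_uniform01 by (rule eventually_mono) (use 2 equilibrium_price_bounds in force)
      then have "U.prob {u. equilibrium_price u \<le> p} = 1" by (subst U.prob_eq_1) auto
      then show ?thesis using 2 Q by (simp add: equilibrium_cdf_def)
    next
      case 3
      define g where "g = (1 - (1 - \<pi>) * Q / p) / \<pi>"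
      \<comment> \<open>Seeds up to \<open>g\<close> give prices up to \<open>p\<close>. The bound
        \<open>g < 1\<close> keeps this interval within [0, 1]; a negative \<open>g\<close> makes it
        empty, whence the \<open>max\<close>.\<close>
      have "g < 1" using 3 pi mult_strict_left_mono[of p Q "1 - \<pi>"] by (simp add: g_def field_simps)
      have iff: "equilibrium_price u \<le> p \<longleftrightarrow> u \<le> g" if "u \<in> {0..1}" for u
        using denominator_pos[OF that] pi 3 by (simp add: g_def equilibrium_price_def field_simps)
      have "U.prob {u. equilibrium_price u \<le> p} =
          measure lborel ({0..1} \<inter> {u. equilibrium_price u \<le> p})"
        unfolding uniform01_def by (subst measure_uniform_measure) auto
      also have "{0..1} \<inter> {u. equilibrium_price u \<le> p} = {0..g}"
        using iff \<open>g < 1\<close> by auto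
      also have "measure lborel {0..g} = max 0 g" by (simp add: max_def)
      finally show ?thesis using 3 by (simp add: equilibrium_cdf_def g_def)
    qed
  qed
  finally show ?thesis .
qed

text \<open>A CDF determines its distribution. This will resolve the \<open>THE\<close> in
  \<open>symmetric_price_dist\<close>.\<close>

lemma equilibrium_dist_unique:
  assumes "price_dist G" "0 < \<tau>" "\<tau> \<le> 1"
    and "\<And>p p'. p \<in> supp G \<Longrightarrow> 0 \<le> p' \<Longrightarrow> profit \<tau> G p' \<le> profit \<tau> G p"
  shows "G = equilibrium_dist"
proof (rule cdf_unique)
  show "real_distribution G" using assms(1)
    by (intro real_distribution.intro real_distribution_axioms.intro) (auto simp: price_dist_def)
  show "cdf G = cdf equilibrium_dist"
    using cdf_eq_equilibrium_cdf[OF assms] cdf_equilibrium_dist by auto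
qed (rule real_distribution_equilibrium_dist)

sublocale eq: real_distribution equilibrium_dist
  by (rule real_distribution_equilibrium_dist)

lemma AE_equilibrium_dist: "AE p in equilibrium_dist. p \<in> {(1 - \<pi>) * Q..Q}"
  unfolding equilibrium_dist_def
proof (subst AE_distr_iff)
  show "AE u in uniform01. equilibrium_price u \<in> {(1 - \<pi>) * Q..Q}"
    using AE_uniform01 by (rule eventually_mono) (rule equilibrium_price_bounds)
qed auto

lemma price_dist_equilibrium_dist: "price_dist equilibrium_dist"
  unfolding price_dist_def using AE_equilibrium_dist pi Q eq.prob_space_axioms
  by (auto elim!: eventually_mono intro: order_trans[rotated])

text \<open>The quantile function is injective on [0, 1], so a single price comes from at most one
  seed.\<close>

lemma equilibrium_dist_atomless: "measure equilibrium_dist {p} = 0"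
proof -
  interpret U: prob_space uniform01 by (rule prob_space_uniform01)
  have "measure equilibrium_dist {p} = U.prob {u. equilibrium_price u = p}"
    unfolding equilibrium_dist_def
    by (subst measure_distr) (auto simp: vimage_def sets_eq_imp_space_eq[OF sets_uniform01])
  also have "\<dots> = measure lborel ({0..1} \<inter> {u. equilibrium_price u = p})"
    unfolding uniform01_def by (subst measure_uniform_measure) auto
  also have "\<dots> = 0"
  proof -
    have "{0..1} \<inter> {u. equilibrium_price u = p} \<subseteq> {(1 - (1 - \<pi>) * Q / p) / \<pi>}"
    proof safe
      fix u :: real assume u: "u \<in> {0..1}" and p: "p = equilibrium_price u"
      show "u = (1 - (1 - \<pi>) * Q / equilibrium_price u) / \<pi>"
        using denominator_pos[OF u] pi Q by (simp add: equilibrium_price_def)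
    qed
    then have "finite ({0..1} \<inter> {u. equilibrium_price u = p})" by (rule finite_subset) simp
    then show ?thesis by (simp add: emeasure_lborel_countable countable_finite measure_def)
  qed
  finally show ?thesis .
qed

lemma equilibrium_indifference:
  assumes "p \<in> {(1 - \<pi>) * Q..Q}"
  shows "p * (1 - \<pi> * measure equilibrium_dist {..<p}) = (1 - \<pi>) * Q"
proof -
  have "0 < (1 - \<pi>) * Q" using pi Q by simp
  then have p: "0 < p" "(1 - \<pi>) * Q \<le> p" "p \<le> Q" using assms by auto
  have "equilibrium_cdf p = measure equilibrium_dist ({..<p} \<union> {p})"
    unfolding cdf_equilibrium_dist[symmetric] cdf_def by (rule arg_cong[where f=eq.prob]) auto
  also have "\<dots> = measure equilibrium_dist {..<p}"
    by (subst eq.finite_measure_Union) (auto simp: equilibrium_dist_atomless)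
  finally have eq: "measure equilibrium_dist {..<p} = equilibrium_cdf p" ..
  show ?thesis
  proof (cases "p = Q")
    case True
    then show ?thesis using eq Q by (simp add: equilibrium_cdf_def)
  next
    case False
    \<comment> \<open>From the lowest price on, the cutoff at 0 is inactive and the CDF is the
      solution of the indifference equation.\<close>
    have "0 \<le> (1 - (1 - \<pi>) * Q / p) / \<pi>" using p pi by (simp add: field_simps)
    then show ?thesis using False p pi by (simp add: eq equilibrium_cdf_def field_simps)
  qed
qed

text \<open>All prices between \<open>(1 - \<pi>) * Q\<close> and \<open>Q\<close> earn the same. A
  lower price earns less even if it wins every fitting consumer; a higher one is always undercut and
  loses to the monopoly price \<open>Q\<close> on the remaining consumers. Without atoms,
  \<open>\<tau>\<close> may be arbitrary.\<close>

lemma equilibrium_dist_optimal: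
  assumes "p \<in> supp equilibrium_dist" "0 \<le> p'"
  shows "profit \<tau> equilibrium_dist p' \<le> profit \<tau> equilibrium_dist p"
proof -
  have p: "p \<in> {(1 - \<pi>) * Q..Q}"
    using supp_subset_closed[OF _ AE_equilibrium_dist] assms(1) by auto
  have val: "profit \<tau> equilibrium_dist q = \<pi> * ((1 - \<pi>) * Q)" if "q \<in> {(1 - \<pi>) * Q..Q}" for q
    using equilibrium_indifference[OF that] that
    by (simp add: profit_def equilibrium_dist_atomless demand_eq_1)
  have "profit \<tau> equilibrium_dist p' \<le> \<pi> * ((1 - \<pi>) * Q)"
  proof -
    consider "p' < (1 - \<pi>) * Q" | "p' \<in> {(1 - \<pi>) * Q..Q}" | "Q < p'" by force
    then show ?thesis
    proof cases
      case 1
      define X where "X = 1 - \<pi> * measure equilibrium_dist {..<p'}"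
      have "\<pi> * measure equilibrium_dist {..<p'} \<le> 1 * 1"
        using pi by (intro mult_mono) auto
      then have X: "0 \<le> X" "X \<le> 1" using pi by (simp_all add: X_def)
      have "(p' * demand p') * X \<le> (p' * 1) * 1"
        using assms(2) demand_bounds X by (intro mult_mono mult_left_mono) auto
      then have "(p' * demand p') * X \<le> (1 - \<pi>) * Q"
        using 1 by linarith
      then have "\<pi> * ((p' * demand p') * X) \<le> \<pi> * ((1 - \<pi>) * Q)" using pi by simp
      then show ?thesis by (simp add: profit_def equilibrium_dist_atomless X_def mult.assoc)
    next
      case 2
      then show ?thesis by (simp add: val)
    next
      case 3
      have "AE q in equilibrium_dist. q \<in> {..<p'}"
        using AE_equilibrium_dist by (rule eventually_mono) (use 3 in auto)
      then have "measure equilibrium_dist {..<p'} = 1" by (subst eq.prob_eq_1) auto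
      moreover have "\<pi> * ((p' * demand p') * (1 - \<pi>)) \<le> \<pi> * (Q * (1 - \<pi>))"
        using mult_demand_le[OF assms(2)] pi by (intro mult_left_mono mult_right_mono) auto
      ultimately show ?thesis by (simp add: profit_def equilibrium_dist_atomless mult_ac)
    qed
  qed
  then show ?thesis using val[OF p] by simp
qed

end

section \<open>The example market\<close>

text \<open>The four equally likely lists are two independent fair screens. The search degree is the
  only parameter, so two such markets are identical otherwise. The rule of always charging 0 is
  demand-responsive because the index is then positive at the maximal value; equilibrium prices come
  from \<open>market_equilibrium\<close>, not from this rule.\<close>

definition example_market :: "nat \<Rightarrow> market" where
  "example_market k =
    \<lparr> num_businesses = 2, num_screens = 2, search_degree = k, search_cost = 0,
      value_density = indicator {1..2},
      screen_law = (\<lambda>_. pmf_of_set {[True, True], [True, False], [False, True], [False, False]}),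
      screen_param = (\<lambda>_ _. 1 / 2),
      screen_prior = (\<lambda>_ _. return borel (1 / 2)),
      pricing_rule = (\<lambda>_ _ _. 0) \<rparr>"

lemma example_market_simps [simp]:
  "num_businesses (example_market k) = 2"
  "num_screens (example_market k) = 2"
  "search_degree (example_market k) = k"
  "search_cost (example_market k) = 0"
  "value_density (example_market k) = indicator {1..2}"
  "screen_law (example_market k) j =
    pmf_of_set {[True, True], [True, False], [False, True], [False, False]}"
  "screen_param (example_market k) j l = 1 / 2"
  "screen_prior (example_market k) j l = return borel (1 / 2)"
  "pricing_rule (example_market k) j h z = 0"
  by (simp_all add: example_market_def)

section \<open>The uniform value distribution\<close>

lemma value_dist_example: "value_dist (example_market k) = uniform_measure lborel {1..2}"
  by (simp add: value_dist_def uniform_measure_def ennreal_indicator divide_ennreal_def)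

lemma prob_space_value_dist: "prob_space (value_dist (example_market k))"
  unfolding value_dist_example by (rule prob_space_uniform_measure) auto

lemma sets_value_dist [measurable_cong, simp]: "sets (value_dist M) = sets borel"
  by (simp add: value_dist_def)

lemma AE_value_dist: "AE v in value_dist (example_market k). v \<in> {1<..2}"
proof -
  have "AE v in lborel. v \<noteq> (1 :: real)" by (rule AE_lborel_singleton)
  then have "AE v in lborel. v \<in> {1..2} \<longrightarrow> v \<in> {1<..2 :: real}" by eventually_elim auto
  then show ?thesis unfolding value_dist_example by (intro AE_uniform_measureI) auto
qed

lemma mean_value:
  "has_bochner_integral (value_dist (example_market k)) (\<lambda>v. v) (3 / 2)"
proof -
  have "has_bochner_integral lborel (\<lambda>x. x * indicator {1..2} x) (2\<^sup>2 / 2 - 1\<^sup>2 / 2 :: real)"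
    by (rule has_bochner_integral_FTC_Icc_nonneg) (auto intro!: derivative_eq_intros)
  then show ?thesis unfolding value_dist_def
    by (intro has_bochner_integral_density) (auto simp: mult.commute)
qed

lemma cdf_value_dist:
  "cdf (value_dist (example_market k)) v = min 1 (max 0 (v - 1))"
proof -
  have "cdf (value_dist (example_market k)) v = measure lborel ({1..2} \<inter> {..v})"
    unfolding cdf_def value_dist_example by (subst measure_uniform_measure) auto
  also have "{1..2} \<inter> {..v} = {1..min v 2}" by auto
  finally show ?thesis by (auto simp: min_def max_def)
qed

text \<open>The three pieces are increasing and fit together: the virtual value is minus infinity
  before the support, at most 2 on [1, 2], and \<open>v\<close> itself beyond, where the extended
  reals give \<open>0 / 0 = 0\<close>.\<close>

lemma regular_values_example: "regular_values (example_market k)"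
proof -
  define M where "M = example_market k"
  have v1: "virtual_value M v = - \<infinity>" if "v < 1" for v
    using that by (simp add: M_def virtual_value_def cdf_value_dist divide_ereal_def)
  have v2: "virtual_value M v = ereal (2 * v - 2)" if "1 \<le> v" "v \<le> 2" for v
    using that by (simp add: M_def virtual_value_def cdf_value_dist)
  have v3: "virtual_value M v = ereal v" if "2 < v" for v
    using that by (simp add: M_def virtual_value_def cdf_value_dist zero_ereal_def[symmetric])
  have "virtual_value M u \<le> virtual_value M v" if "u \<le> v" for u v
    using that v1 v2 v3
    by (cases "u < 1"; cases "u \<le> 2"; cases "v < 1"; cases "v \<le> 2") auto
  then show ?thesis by (simp add: regular_values_def M_def mono_on_def)
qed

lemma supp_value_dist: "supp (value_dist (example_market k)) \<subseteq> {1..2}"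
proof (rule supp_subset_closed)
  show "AE v in value_dist (example_market k). v \<in> {1..2}"
    using AE_value_dist[of k] by (rule eventually_mono) auto
qed auto

lemma bdd_above_supp: "bdd_above (supp (value_dist (example_market k)))"
  by (rule bdd_above_mono[OF _ supp_value_dist]) simp

text \<open>The support has full measure, so it is non-empty, and it lies in [1, 2].\<close>

lemma max_value_pos: "0 < max_value (example_market k)"
proof -
  interpret prob_space "value_dist (example_market k)" by (rule prob_space_value_dist)
  have "supp (value_dist (example_market k)) \<noteq> {}"
    using AE_in_supp[of "value_dist (example_market k)"] by auto
  then obtain x where "x \<in> supp (value_dist (example_market k))" by blast
  moreover from this have "1 \<le> x" using supp_value_dist[of k] by auto
  ultimately show ?thesis
    unfolding max_value_def using cSup_upper[OF _ bdd_above_supp[of k], of x] by auto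
qed

locale example =
  fixes k :: nat
  assumes k: "k = 1 \<or> k = 2"
begin

abbreviation "M \<equiv> example_market k"

text \<open>\<open>k\<close> of the two fair screens make up the fit and the other
  \<open>2 - k\<close> the quality.\<close>

sublocale duopoly "(1 / 2) ^ k" "(1 / 2) ^ (2 - k)"
  using k by unfold_locales (auto simp: power2_eq_square)

abbreviation "\<pi> \<equiv> (1 / 2 :: real) ^ k"
abbreviation "q \<equiv> (1 / 2 :: real) ^ (2 - k)"

section \<open>Beliefs stay at the true parameters\<close>

lemma true_fit: "true_fit M j = \<pi>" and true_quality: "true_quality M j = q"
  by (auto simp: fit_prob_def quality_def)

text \<open>The type \<open>outcome\<close> admits failures at any index, whereas the prior lives on
  screens below 2 only. Restricting to failures that can occur keeps likelihoods functions of those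
  coordinates.\<close>

definition valid_outcome :: "outcome option \<Rightarrow> bool" where
  "valid_outcome x \<longleftrightarrow> (\<forall>i. x = Some (FailAt i) \<longrightarrow> i < 2)"

definition valid_history :: "entry list \<Rightarrow> bool" where
  "valid_history h \<longleftrightarrow>
    (\<forall>e\<in>set h. \<forall>j. valid_outcome (inspected e j) \<and> valid_outcome (feedback e j))"

lemma valid_observed: "b \<le> 2 \<Longrightarrow> valid_outcome (Some (observed a b f))"
proof -
  assume b: "b \<le> 2"
  have "(LEAST l. l \<in> {a..<b} \<and> \<not> f ! l) < 2" if "\<not> (\<forall>l\<in>{a..<b}. f ! l)"
  proof -
    have "\<exists>l. l \<in> {a..<b} \<and> \<not> f ! l" using that by blast
    from LeastI_ex[OF this] have "(LEAST l. l \<in> {a..<b} \<and> \<not> f ! l) \<in> {a..<b}"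
      by (rule conjunct1)
    then show ?thesis using b unfolding atLeastLessThan_iff by linarith
  qed
  then show ?thesis
    by (auto simp: valid_outcome_def observed_def simp del: atLeastLessThan_iff split: if_splits)
qed

lemma valid_history: "valid_history (history M \<omega> i)"
proof (induction i)
  case (Suc i)
  obtain v f t z where \<omega>: "\<omega> i = ((v, f, t), z)" by (metis surj_pair)
  show ?case
    using Suc k valid_observed unfolding valid_history_def
    by (auto simp: \<omega> Let_def) (auto simp: valid_outcome_def)
qed (simp add: valid_history_def)

lemma joint_prior: "joint_prior M = (\<Pi>\<^sub>M j\<in>{..<2}. \<Pi>\<^sub>M l\<in>{..<2}. return borel (1 / 2))"
  by (simp add: joint_prior_def)

lemma prob_space_joint_prior: "prob_space (joint_prior M)"
  unfolding joint_prior by (intro prob_space_PiM prob_space_return) auto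

lemma AE_joint_prior: "AE \<theta> in joint_prior M. \<forall>j<2. \<forall>l<2. \<theta> j l = 1 / 2"
proof -
  have ret: "AE x in return borel (1 / 2 :: real). x = 1 / 2"
    by (subst AE_return) auto
  have "AE \<theta> in joint_prior M. \<forall>j\<in>{..<2}. \<forall>l\<in>{..<2}. \<theta> j l = 1 / 2"
    unfolding joint_prior
    by (intro AE_finite_allI AE_PiM_component[where P="\<lambda>\<theta>. \<forall>l\<in>{..<2}. \<theta> l = 1 / 2"]
          AE_PiM_component[where P="\<lambda>x. x = 1 / 2"] prob_space_PiM prob_space_return ret) auto
  then show ?thesis by (simp add: Ball_def)
qed

lemma measurable_param:
  "j < 2 \<Longrightarrow> l < 2 \<Longrightarrow> (\<lambda>\<theta>. \<theta> j l) \<in> borel_measurable (joint_prior M)"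
proof -
  assume "j < 2" "l < 2"
  then have "(\<lambda>\<theta>. \<theta> j l) \<in> joint_prior M \<rightarrow>\<^sub>M return borel (1 / 2 :: real)"
    unfolding joint_prior
    by (intro measurable_compose[OF measurable_component_singleton[of j]
          measurable_component_singleton[of l]]) auto
  moreover have "joint_prior M \<rightarrow>\<^sub>M return borel (1 / 2 :: real) = borel_measurable (joint_prior M)"
    by (rule measurable_cong_sets) auto
  ultimately show "(\<lambda>\<theta>. \<theta> j l) \<in> borel_measurable (joint_prior M)" by (rule subst[rotated])
qed

lemma outcome_prob_measurable:
  assumes "j < 2" "b \<le> 2" "valid_outcome (Some s)"
  shows "(\<lambda>\<theta>. outcome_prob (\<theta> j) a b s) \<in> borel_measurable (joint_prior M)"
  using assms
  by (cases s) (auto simp: valid_outcome_def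
      intro!: borel_measurable_prod borel_measurable_times borel_measurable_diff measurable_param)

lemma outcome_prob_half:
  assumes "b \<le> 2" "valid_outcome (Some s)" "\<And>l. l < 2 \<Longrightarrow> x l = 1 / 2"
  shows "outcome_prob x a b s = outcome_prob (\<lambda>_. 1 / 2) a b s"
proof -
  have "prod x {a..<c} = (1 / 2) ^ (c - a)" if "c \<le> 2" for c
    using that assms(3) by (subst prod.cong[OF refl, of _ x "\<lambda>_. 1 / 2"]) auto
  then show ?thesis
    using assms(1,2) by (cases s) (simp_all add: valid_outcome_def assms(3))
qed

lemma outcome_prob_half_pos: "0 < outcome_prob (\<lambda>_. 1 / 2) a b s"
  by (cases s) auto

text \<open>Needed to replace the likelihood by a constant under the integral and the density; the
  induction follows the list product.\<close>

lemma likelihood_measurable: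
  "valid_history h \<Longrightarrow> likelihood M h \<in> borel_measurable (joint_prior M)"
proof (induction h)
  case (Cons e h)
  then have e: "valid_outcome (inspected e j)" "valid_outcome (feedback e j)" for j
    by (auto simp: valid_history_def)
  have h: "likelihood M h \<in> borel_measurable (joint_prior M)"
    using Cons by (auto simp: valid_history_def)
  have "(\<lambda>\<theta>. \<Prod>j\<in>{..<2}.
      (case inspected e j of None \<Rightarrow> 1 | Some s \<Rightarrow> outcome_prob (\<theta> j) 0 k s) *
      (case feedback e j of None \<Rightarrow> 1 | Some s \<Rightarrow> outcome_prob (\<theta> j) k 2 s))
      \<in> borel_measurable (joint_prior M)"
  proof (intro borel_measurable_prod borel_measurable_times)
    fix j :: nat assume j: "j \<in> {..<2}"
    show "(\<lambda>\<theta>. case inspected e j of None \<Rightarrow> 1 | Some s \<Rightarrow> outcome_prob (\<theta> j) 0 k s)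
        \<in> borel_measurable (joint_prior M)"
      using e(1)[of j] j k outcome_prob_measurable[of j k _ 0] by (cases "inspected e j") auto
    show "(\<lambda>\<theta>. case feedback e j of None \<Rightarrow> 1 | Some s \<Rightarrow> outcome_prob (\<theta> j) k 2 s)
        \<in> borel_measurable (joint_prior M)"
      using e(2)[of j] j outcome_prob_measurable[of j 2 _ k] by (cases "feedback e j") auto
  qed
  note borel_measurable_times[OF this h]
  also have "(\<lambda>\<theta>. (\<Prod>j\<in>{..<2}.
      (case inspected e j of None \<Rightarrow> 1 | Some s \<Rightarrow> outcome_prob (\<theta> j) 0 k s) *
      (case feedback e j of None \<Rightarrow> 1 | Some s \<Rightarrow> outcome_prob (\<theta> j) k 2 s)) * likelihood M h \<theta>) =
      likelihood M (e # h)"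
    by (rule ext) (simp only: likelihood_def list.map prod_list.Cons example_market_simps)
  finally show ?case .
qed (simp add: likelihood_def[abs_def])

lemma likelihood_half:
  assumes "valid_history h" "\<forall>j<2. \<forall>l<2. \<theta> j l = 1 / 2"
  shows "likelihood M h \<theta> = likelihood M h (\<lambda>_ _. 1 / 2)"
  unfolding likelihood_def
proof (intro arg_cong[where f=prod_list] map_cong refl prod.cong arg_cong2[where f="(*)"])
  fix e j assume "e \<in> set h" "j \<in> businesses M"
  then have e: "valid_outcome (inspected e j)" "valid_outcome (feedback e j)" and j: "j < 2"
    using assms(1) by (auto simp: valid_history_def)
  show "(case inspected e j of None \<Rightarrow> 1 | Some s \<Rightarrow> outcome_prob (\<theta> j) 0 (search_degree M) s) =
      (case inspected e j of None \<Rightarrow> 1 | Some s \<Rightarrow> outcome_prob (\<lambda>_. 1 / 2) 0 (search_degree M) s)"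
    using e(1) assms(2) j k outcome_prob_half[of k _ "\<theta> j" 0] by (cases "inspected e j") auto
  show "(case feedback e j of None \<Rightarrow> 1
        | Some s \<Rightarrow> outcome_prob (\<theta> j) (search_degree M) (num_screens M) s) =
      (case feedback e j of None \<Rightarrow> 1
        | Some s \<Rightarrow> outcome_prob (\<lambda>_. 1 / 2) (search_degree M) (num_screens M) s)"
    using e(2) assms(2) j outcome_prob_half[of 2 _ "\<theta> j" k] by (cases "feedback e j") auto
qed

lemma likelihood_half_pos: "0 < likelihood M h (\<lambda>_ _. 1 / 2)"
  unfolding likelihood_def
  by (induction h)
    (auto intro!: prod_pos mult_pos_pos outcome_prob_half_pos split: option.split)

text \<open>The prior is a point mass, so the likelihood is almost surely a positive constant. It
  cancels against the normalizing integral, and Bayes' rule changes nothing.\<close>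

lemma posterior_eq: "valid_history h \<Longrightarrow> posterior M h = joint_prior M"
proof -
  assume h: "valid_history h"
  interpret prob_space "joint_prior M" by (rule prob_space_joint_prior)
  define L where "L = likelihood M h (\<lambda>_ _. 1 / 2)"
  have L: "0 < L" unfolding L_def by (rule likelihood_half_pos)
  have AE: "AE \<theta> in joint_prior M. likelihood M h \<theta> = L"
    using AE_joint_prior unfolding L_def by (rule eventually_mono) (rule likelihood_half[OF h])
  then have "(\<integral>\<theta>. likelihood M h \<theta> \<partial>joint_prior M) = (\<integral>\<theta>. L \<partial>joint_prior M)"
    by (rule integral_cong_AE[OF likelihood_measurable[OF h] borel_measurable_const])
  also have "\<dots> = L" by (simp add: prob_space)
  finally have "posterior M h = density (joint_prior M) (\<lambda>\<theta>. ennreal (likelihood M h \<theta> / L))"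
    by (simp only: posterior_def)
  also have "\<dots> = density (joint_prior M) (\<lambda>_. 1)"
  proof (rule density_cong)
    show "AE \<theta> in joint_prior M. ennreal (likelihood M h \<theta> / L) = 1"
      using AE by (rule eventually_mono) (use L in simp)
  qed (use likelihood_measurable[OF h] in simp_all)
  finally show ?thesis by (simp only: density_1)
qed

lemma fit_quality_half:
  assumes "\<forall>j<2. \<forall>l<2. \<theta> j l = 1 / 2" "j < 2"
  shows "fit_prob M \<theta> j = \<pi>" "quality M \<theta> j = q"
proof -
  have "fit_prob M \<theta> j = (\<Prod>l<k. 1 / 2)" unfolding fit_prob_def example_market_simps
    by (rule prod.cong) (use assms k in auto)
  then show "fit_prob M \<theta> j = \<pi>" by simp
  have "quality M \<theta> j = (\<Prod>l=k..<2. 1 / 2)" unfolding quality_def example_market_simps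
    by (rule prod.cong) (use assms in auto)
  then show "quality M \<theta> j = q" by simp
qed

text \<open>This holds on every path and in every round, since the histories produced by the
  dynamics are all valid. Learning, loss and demand responsiveness thereby become
  deterministic.\<close>

lemma belief_at_eq:
  assumes "j < 2" shows "belief_at M \<omega> i j = return borel (\<pi>, q)"
proof -
  interpret prob_space "joint_prior M" by (rule prob_space_joint_prior)
  have "belief_at M \<omega> i j =
      distr (joint_prior M) borel (\<lambda>\<theta>. (fit_prob M \<theta> j, quality M \<theta> j))"
    unfolding belief_at_def belief_def by (simp add: posterior_eq valid_history)
  also have "\<dots> = distr (joint_prior M) borel (\<lambda>_. (\<pi>, q))"
  proof (intro distr_cong_AE refl)
    show "AE \<theta> in joint_prior M. (fit_prob M \<theta> j, quality M \<theta> j) = (\<pi>, q)"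
      using AE_joint_prior by (rule eventually_mono) (simp add: fit_quality_half assms)
    have [measurable]: "(\<lambda>\<theta>. fit_prob M \<theta> j) \<in> borel_measurable (joint_prior M)"
      "(\<lambda>\<theta>. quality M \<theta> j) \<in> borel_measurable (joint_prior M)"
      unfolding fit_prob_def quality_def using assms k
      by (auto intro!: borel_measurable_prod measurable_param)
    show "(\<lambda>\<theta>. (fit_prob M \<theta> j, quality M \<theta> j)) \<in> joint_prior M \<rightarrow>\<^sub>M borel"
      by measurable
  qed simp
  finally show ?thesis by simp
qed

lemma learned_belief_eq: "learned_belief M j = return borel (\<pi>, q)"
  by (simp add: learned_belief_def true_fit true_quality)

lemma index_eq: "index M p (return borel (\<pi>, q)) v = v * q - p"
proof -
  have [measurable]: "snd \<in> borel_measurable (borel :: (real \<times> real) measure)"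
    by (intro borel_measurable_continuous_onI continuous_on_snd continuous_on_id)
  show ?thesis by (simp add: index_def mean_quality_def integral_return)
qed

section \<open>Learning and the market conditions\<close>

lemma prob_space_consumer_law: "prob_space (consumer_law M)"
  unfolding consumer_law_def
  by (intro prob_space_pair prob_space_value_dist prob_space_PiM prob_space_uniform01
      prob_space_measure_pmf)

lemma prob_space_process: "prob_space (process M)"
  unfolding process_def
  by (intro prob_space_PiM prob_space_pair prob_space_consumer_law prob_space_uniform01)

text \<open>The belief is already the point mass at the truth, so no mass lies at a positive
  distance from it.\<close>

lemma learned_set_eq: "learned_set M \<omega> = {..<2}"
proof -
  have "learned M \<omega> j" if "j < 2" for j
    using that by (simp add: learned_def belief_at_eq true_fit true_quality measure_return)
  then show ?thesis by (auto simp: learned_set_def)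
qed

lemma not_lost: "j < 2 \<Longrightarrow> \<not> lost M \<omega> j"
  using max_value_pos[of k] Q
  by (auto simp: lost_def lost_belief_def belief_at_eq index_eq not_le)

lemma learned_symmetric: "learned_symmetric M"
  by (simp add: learned_symmetric_def true_fit true_quality)

lemma no_business_lost: "no_business_lost M"
  by (simp add: no_business_lost_def not_lost)

lemma demand_responsive: "demand_responsive M"
  using max_value_pos[of k] Q
  by (simp add: demand_responsive_def belief_at_eq index_eq price_def)

lemma screen_law_prob:
  "measure_pmf.prob (screen_law M j) A =
    card ({[True, True], [True, False], [False, True], [False, False]} \<inter> A) / 4"
  unfolding example_market_simps by (subst measure_pmf_of_set) auto

lemma screen_param_cond_prob:
  assumes "l < 2"
  shows "\<P>(f in measure_pmf (screen_law M j). f ! l \<bar> \<forall>i<l. f ! i) = 1 / 2"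
proof -
  have first: "(\<forall>i<Suc 0. f ! i) \<longleftrightarrow> f ! 0" for f :: "bool list" by auto
  consider "l = 0" | "l = Suc 0" using assms by linarith
  then show ?thesis
  proof cases
    case 1
    then show ?thesis
      unfolding cond_prob_def screen_law_prob by (simp add: Int_insert_left)
  next
    case 2
    then show ?thesis
      unfolding cond_prob_def screen_law_prob \<open>l = Suc 0\<close> first by (simp add: Int_insert_left)
  qed
qed

lemma is_market: "is_market M"
proof -
  have AE_fit: "AE \<theta> in joint_prior M. 0 < fit_prob M \<theta> j \<and> fit_prob M \<theta> j < 1" if "j < 2" for j
    using AE_joint_prior
    by (rule eventually_mono) (use pi in \<open>simp add: fit_quality_half that del: power_one_over\<close>)
  show ?thesis
    unfolding is_market_def
  proof (intro conjI ballI allI impI)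
    show "search_degree M \<le> num_screens M" using k by auto
    show "AE v in value_dist M. 0 \<le> v"
      using AE_value_dist[of k] by (rule eventually_mono) auto
    show "demand_responsive M" by (rule demand_responsive)
  next
    fix j assume "j \<in> businesses M"
    then show "AE \<theta> in joint_prior M. 0 < fit_prob M \<theta> j \<and> fit_prob M \<theta> j < 1"
      by (intro AE_fit) simp
  next
    fix j f assume "f \<in> set_pmf (screen_law M j)"
    then show "length f = num_screens M" by (auto simp: set_pmf_of_set)
  next
    fix j l assume "l < num_screens M"
    then show "screen_param M j l =
        \<P>(f in measure_pmf (screen_law M j). f ! l \<bar> \<forall>i<l. f ! i)"
      by (subst screen_param_cond_prob) auto
    show "AE x in screen_prior M j l. 0 \<le> x \<and> x \<le> 1"
      unfolding example_market_simps by (subst AE_return) auto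
    show "screen_param M j l \<in> supp (screen_prior M j l)"
      by (simp add: supp_def)
  qed (use pi in \<open>simp_all add: true_fit prob_space_value_dist bdd_above_supp
        regular_values_example price_def prob_space_return del: power_one_over\<close>)
qed

section \<open>Revenue and equilibrium prices\<close>

text \<open>All businesses share the law of business 0, which turns the joint law of the screens
  into a power of one measure.\<close>

definition screens :: "bool list measure" where
  "screens = measure_pmf (screen_law M 0)"

definition passes :: "bool list \<Rightarrow> bool" where
  "passes x \<longleftrightarrow> (\<forall>l<k. x ! l)"

lemma fits_eq: "fits M f j \<longleftrightarrow> passes (f j)"
  by (simp add: fits_def passes_def)

lemma prob_space_screens: "prob_space screens"
  by (simp add: screens_def prob_space_measure_pmf)

lemma sets_screens [measurable_cong, simp]: "sets screens = UNIV"
  by (simp add: screens_def)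

lemma measurable_screens [measurable, simp]: "f \<in> measurable screens N \<longleftrightarrow> f \<in> UNIV \<rightarrow> space N"
  by (auto simp: screens_def)

lemma consumer_law_eq:
  "consumer_law M =
    value_dist M \<Otimes>\<^sub>M ((\<Pi>\<^sub>M _\<in>{..<2}. screens) \<Otimes>\<^sub>M (\<Pi>\<^sub>M _\<in>{..<2}. uniform01))"
  by (simp add: consumer_law_def screens_def)

lemma has_bochner_integral_passes:
  "has_bochner_integral screens (\<lambda>x. of_bool (passes x)) \<pi>"
proof -
  have "measure screens {x. passes x} = \<pi>"
    using k unfolding screens_def screen_law_prob passes_def
    by (auto simp: Int_insert_left less_2_cases_iff all_conj_distrib power2_eq_square)
  moreover have "(\<lambda>x. of_bool (passes x) :: real) = indicator {x. passes x}"
    by (auto simp: indicator_def)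
  moreover have "has_bochner_integral screens (indicator {x. passes x}) (measure screens {x. passes x})"
    by (rule has_bochner_integral_real_indicator)
       (auto simp: finite_measure.emeasure_finite prob_space.finite_measure prob_space_screens
          less_top[symmetric])
  ultimately show ?thesis by simp
qed

lemma has_bochner_integral_demand:
  "has_bochner_integral (value_dist M) (\<lambda>v. of_bool (0 < v * q - p)) (demand p)"
proof -
  have "measure (value_dist M) {v. 0 < v * q - p} = measure lborel ({1..2} \<inter> {v. p / q < v})"
    unfolding value_dist_example using Q
    by (subst measure_uniform_measure) (auto simp: field_simps)
  also have "\<dots> = demand p"
  proof -
    define x where "x = p / q"
    consider "x < 1" | "1 \<le> x" "x \<le> 2" | "2 < x" by linarith
    then have "measure lborel ({1..2} \<inter> {v. x < v}) = min 1 (max 0 (2 - x))"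
    proof cases
      case 1
      then have "{1..2} \<inter> {v. x < v} = {1..2}" by auto
      then show ?thesis using 1 by simp
    next
      case 2
      then have "{1..2} \<inter> {v. x < v} = {x<..2}" by auto
      then show ?thesis using 2 by simp
    next
      case 3
      then have "{1..2} \<inter> {v. x < v} = {}" by auto
      then show ?thesis using 3 by simp
    qed
    then show ?thesis by (simp only: demand_def x_def)
  qed
  finally have "measure (value_dist M) {v. 0 < v * q - p} = demand p" .
  moreover have "(\<lambda>v. of_bool (0 < v * q - p) :: real) = indicator {v. 0 < v * q - p}"
    by (auto simp: indicator_def)
  moreover have "has_bochner_integral (value_dist M) (indicator {v. 0 < v * q - p})
      (measure (value_dist M) {v. 0 < v * q - p})"
    by (rule has_bochner_integral_real_indicator)
       (auto simp: finite_measure.emeasure_finite prob_space.finite_measure prob_space_value_dist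
          less_top[symmetric])
  ultimately show ?thesis by simp
qed

text \<open>Prices, value, screens and tie-breaking seeds are independent. Revenue and welfare are
  computed by writing their integrands as combinations of such products.\<close>

lemma has_bochner_integral_consumer:
  fixes G :: "real measure" and a b c d :: real
  assumes "prob_space G"
    and "has_bochner_integral (\<Pi>\<^sub>M _\<in>{..<2::nat}. G) g a"
    and "has_bochner_integral (value_dist M) w b"
    and "has_bochner_integral (\<Pi>\<^sub>M _\<in>{..<2::nat}. screens) \<phi> c"
    and "has_bochner_integral (\<Pi>\<^sub>M _\<in>{..<2::nat}. uniform01) u d"
  shows "has_bochner_integral ((\<Pi>\<^sub>M _\<in>{..<2::nat}. G) \<Otimes>\<^sub>M consumer_law M)
    (\<lambda>(P, v, f, t). g P * (w v * (\<phi> f * u t))) (a * (b * (c * d)))"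
proof -
  have P: "sigma_finite_measure (\<Pi>\<^sub>M _\<in>{..<2::nat}. N)" if "prob_space N" for N :: "'b measure"
    by (intro prob_space_imp_sigma_finite prob_space_PiM that)
  have V: "sigma_finite_measure (value_dist M)"
    by (intro prob_space_imp_sigma_finite prob_space_value_dist)
  have C: "sigma_finite_measure (consumer_law M)"
    by (intro prob_space_imp_sigma_finite prob_space_consumer_law)
  have ST: "sigma_finite_measure ((\<Pi>\<^sub>M _\<in>{..<2::nat}. screens) \<Otimes>\<^sub>M (\<Pi>\<^sub>M _\<in>{..<2::nat}. uniform01))"
    by (intro prob_space_imp_sigma_finite prob_space_pair prob_space_PiM prob_space_screens
        prob_space_uniform01)
  note has_bochner_integral_pair_mult[OF P[OF prob_space_screens] P[OF prob_space_uniform01]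
      assms(4,5)]
  note has_bochner_integral_pair_mult[OF V ST assms(3) this]
  note has_bochner_integral_pair_mult[OF P[OF assms(1)] C[unfolded consumer_law_eq] assms(2) this]
  then show ?thesis by (simp add: consumer_law_eq case_prod_unfold)
qed

section \<open>Tie-breaking and the revenue of a business\<close>

definition tie :: "nat \<Rightarrow> nat \<Rightarrow> real" where
  "tie i j = measure (\<Pi>\<^sub>M _\<in>{..<2::nat}. uniform01)
     {t \<in> space (\<Pi>\<^sub>M _\<in>{..<2::nat}. uniform01). t i < t j \<or> t i = t j \<and> i < j}"

lemma sets_tie:
  assumes "i < 2" "j < 2"
  shows "{t \<in> space (\<Pi>\<^sub>M _\<in>{..<2::nat}. uniform01). t i < t j \<or> t i = t j \<and> i < j}
    \<in> sets (\<Pi>\<^sub>M _\<in>{..<2::nat}. uniform01)"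
proof -
  note coord = measurable_coordinate[OF assms(1) sets_uniform01]
    measurable_coordinate[OF assms(2) sets_uniform01]
  show ?thesis
  proof (cases "i < j")
    case True
    then show ?thesis using borel_measurable_le[OF coord] by (simp add: le_less)
  next
    case False
    then show ?thesis using borel_measurable_less[OF coord] by simp
  qed
qed

text \<open>The comparison of numbers in the last clause makes the two events exact complements.
  Hence one of the businesses loses ties with positive probability, which suffices for excluding
  atoms.\<close>

lemma tie_sum: "tie 0 1 + tie 1 0 = 1"
proof -
  interpret prob_space "\<Pi>\<^sub>M _\<in>{..<2::nat}. uniform01"
    by (intro prob_space_PiM prob_space_uniform01)
  let ?A = "{t \<in> space (\<Pi>\<^sub>M _\<in>{..<2::nat}. uniform01). t 0 < t 1 \<or> t 0 = t 1 \<and> (0::nat) < 1}"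
  have "{t \<in> space (\<Pi>\<^sub>M _\<in>{..<2::nat}. uniform01). t 1 < t 0 \<or> t 1 = t 0 \<and> (1::nat) < 0} =
      space (\<Pi>\<^sub>M _\<in>{..<2::nat}. uniform01) - ?A"
    by auto
  moreover have "?A \<in> events" by (rule sets_tie) auto
  ultimately show ?thesis unfolding tie_def using prob_compl[of ?A] by simp
qed

lemma tie_bounds: "0 \<le> tie i j" "tie i j \<le> 1"
proof -
  interpret prob_space "\<Pi>\<^sub>M _\<in>{..<2::nat}. uniform01"
    by (intro prob_space_PiM prob_space_uniform01)
  show "0 \<le> tie i j" "tie i j \<le> 1" by (simp_all add: tie_def)
qed

text \<open>Sales are the fitting consumers willing to pay \<open>p\<close> (\<open>t0\<close>),
  minus those whom the competitor also fits and serves at a lower price (\<open>t1\<close>) or after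
  winning a tie (\<open>t2\<close>). Each of the three terms factors over the independent sources of
  randomness.\<close>

lemma revenue_eq:
  assumes "i < 2" "j < 2" "i \<noteq> j" and G: "prob_space G" "sets G = sets borel"
    and "\<And>l. l < 2 \<Longrightarrow> \<Gamma> l = G" and B: "\<And>l. l < 2 \<Longrightarrow> B l = learned_belief M l"
  shows "revenue M B \<Gamma> j p = profit (tie i j) G p"
proof -
  note [measurable_cong, simp] = G(2)
  interpret G: prob_space G by (rule G)
  interpret U: prob_space "\<Pi>\<^sub>M _\<in>{..<2::nat}. uniform01"
    by (intro prob_space_PiM prob_space_uniform01)
  have \<Gamma>: "(\<Pi>\<^sub>M l\<in>businesses M. \<Gamma> l) = (\<Pi>\<^sub>M _\<in>{..<2}. G)"
    using assms(6) by (intro PiM_cong) auto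
  define e where "e t = (of_bool (t i < t j \<or> t i = t j \<and> i < j) :: real)" for t :: "nat \<Rightarrow> real"
  define w where "w v = (of_bool (0 < v * q - p) :: real)" for v
  define \<phi> where "\<phi> x = (of_bool (passes x) :: real)" for x
  have 1: "has_bochner_integral (\<Pi>\<^sub>M _\<in>{..<2::nat}. N) (\<lambda>_. 1) (1::real)"
    if "prob_space N" for N :: "'b measure"
    by (intro has_bochner_integral_const prob_space_PiM that)
  have w: "has_bochner_integral (value_dist M) w (demand p)"
    unfolding w_def[abs_def] by (rule has_bochner_integral_demand)
  have \<phi>: "has_bochner_integral screens \<phi> \<pi>"
    unfolding \<phi>_def[abs_def] by (rule has_bochner_integral_passes)
  have \<phi>j: "has_bochner_integral (\<Pi>\<^sub>M _\<in>{..<2}. screens) (\<lambda>f. \<phi> (f j)) \<pi>"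
    by (rule has_bochner_integral_PiM_one[OF prob_space_screens \<phi> assms(2)])
  have \<phi>ij: "has_bochner_integral (\<Pi>\<^sub>M _\<in>{..<2}. screens) (\<lambda>f. \<phi> (f i) * \<phi> (f j)) (\<pi> * \<pi>)"
    by (rule has_bochner_integral_PiM_two[OF prob_space_screens \<phi> \<phi> assms(1-3)])
  have ind: "has_bochner_integral (\<Pi>\<^sub>M _\<in>{..<2}. G) (\<lambda>P. indicator A (P i)) (G.prob A)"
    if "A \<in> sets borel" for A
    using that by (intro has_bochner_integral_PiM_one[OF G(1) _ assms(1)]
        has_bochner_integral_real_indicator) (auto simp: G.emeasure_finite less_top[symmetric])
  have e: "has_bochner_integral (\<Pi>\<^sub>M _\<in>{..<2}. uniform01) e (tie i j)"
  proof -
    have "has_bochner_integral (\<Pi>\<^sub>M _\<in>{..<2}. uniform01)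
        (indicator {t \<in> space (\<Pi>\<^sub>M _\<in>{..<2::nat}. uniform01).
          t i < t j \<or> t i = t j \<and> i < j})
        (tie i j)"
      unfolding tie_def using assms(1,2)
      by (intro has_bochner_integral_real_indicator)
        (auto simp: U.emeasure_finite less_top[symmetric] intro: sets_tie)
    then show ?thesis
      by (rule has_bochner_integral_cong[THEN iffD1, rotated 3]) (auto simp: e_def indicator_def)
  qed
  let ?N = "(\<Pi>\<^sub>M _\<in>{..<2::nat}. G) \<Otimes>\<^sub>M consumer_law M"
  have t0: "has_bochner_integral ?N (\<lambda>(P, v, f, t). 1 * (w v * (\<phi> (f j) * 1)))
      (1 * (demand p * (\<pi> * 1)))"
    by (intro has_bochner_integral_consumer G w \<phi>j 1 prob_space_uniform01)
  have t1: "has_bochner_integral ?N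
      (\<lambda>(P, v, f, t). indicator {..<p} (P i) * (w v * (\<phi> (f i) * \<phi> (f j) * 1)))
      (G.prob {..<p} * (demand p * (\<pi> * \<pi> * 1)))"
    by (intro has_bochner_integral_consumer G w \<phi>ij ind 1 prob_space_uniform01) auto
  have t2: "has_bochner_integral ?N
      (\<lambda>(P, v, f, t). indicator {p} (P i) * (w v * (\<phi> (f i) * \<phi> (f j) * e t)))
      (G.prob {p} * (demand p * (\<pi> * \<pi> * tie i j)))"
    by (intro has_bochner_integral_consumer G w \<phi>ij ind e) auto
  have s: "(\<lambda>(P, v, f, t). p * of_bool (j \<in> transactions (businesses M)
              (\<lambda>l. index M ((P(j := p)) l) (B l) v) t (fits M f))) =
      (\<lambda>z. p * ((case z of (P, v, f, t) \<Rightarrow> 1 * (w v * (\<phi> (f j) * 1))) -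
        ((case z of (P, v, f, t) \<Rightarrow> indicator {..<p} (P i) * (w v * (\<phi> (f i) * \<phi> (f j) * 1))) +
         (case z of (P, v, f, t) \<Rightarrow> indicator {p} (P i) * (w v * (\<phi> (f i) * \<phi> (f j) * e t))))))"
  proof (intro ext, clarify)
    fix P :: "nat \<Rightarrow> real" and v f t
    have idx: "index M x (B l) v = v * q - x" if "l < 2" for x l
      using B[OF that] by (simp add: learned_belief_eq index_eq)
    \<comment> \<open>Qualities are equal, so comparing indices means comparing prices. A competitor
      charging at most \<open>p\<close> has at least the index of \<open>j\<close>, which is
      positive whenever \<open>j\<close> could sell, so positivity of the competitor's index is
      automatic.\<close>
    have "j \<in> transactions (businesses M)
        (\<lambda>l. index M ((P(j := p)) l) (B l) v) t (fits M f) \<longleftrightarrow>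
      passes (f j) \<and> 0 < v * q - p \<and>
      \<not> ((P i < p \<or> P i = p \<and> (t i < t j \<or> t i = t j \<and> i < j)) \<and> passes (f i))"
      unfolding example_market_simps transactions_two[OF assms(1-3)]
      using assms(1-3) by (auto simp: idx fits_eq precedes_def)
    then show "p * of_bool (j \<in> transactions (businesses M)
        (\<lambda>l. index M ((P(j := p)) l) (B l) v) t (fits M f)) =
      p * (1 * (w v * (\<phi> (f j) * 1)) -
        (indicator {..<p} (P i) * (w v * (\<phi> (f i) * \<phi> (f j) * 1)) +
         indicator {p} (P i) * (w v * (\<phi> (f i) * \<phi> (f j) * e t))))"
      by (auto simp: w_def \<phi>_def e_def indicator_def)
  qed
  have "has_bochner_integral ?N
      (\<lambda>(P, v, f, t). p * of_bool (j \<in> transactions (businesses M)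
         (\<lambda>l. index M ((P(j := p)) l) (B l) v) t (fits M f)))
      (p * (1 * (demand p * (\<pi> * 1)) - (G.prob {..<p} * (demand p * (\<pi> * \<pi> * 1)) +
         G.prob {p} * (demand p * (\<pi> * \<pi> * tie i j)))))"
    unfolding s
    by (intro has_bochner_integral_mult_right has_bochner_integral_diff has_bochner_integral_add
        t0 t1 t2)
  then have "revenue M B \<Gamma> j p = p * (1 * (demand p * (\<pi> * 1)) -
      (G.prob {..<p} * (demand p * (\<pi> * \<pi> * 1)) + G.prob {p} * (demand p * (\<pi> * \<pi> * tie i j))))"
    unfolding revenue_def \<Gamma> by (rule has_bochner_integral_integral_eq)
  also have "\<dots> = profit (tie i j) G p"
    by (simp add: profit_def algebra_simps del: power_one_over)
  finally show ?thesis .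
qed

text \<open>Both businesses are learned, so the beliefs are fixed and \<open>revenue_eq\<close>
  reduces equilibrium to optimality of \<open>profit\<close>; existence and uniqueness were settled
  there.\<close>

lemma symmetric_price_dist_eq: "symmetric_price_dist M {..<2} = equilibrium_dist"
  unfolding symmetric_price_dist_def
proof (rule the_equality)
  show "\<exists>B \<Gamma>. market_equilibrium M {..<2} B \<Gamma> \<and> (\<forall>j\<in>{..<2}. \<Gamma> j = equilibrium_dist)"
  proof (intro exI conjI)
    let ?B = "learned_belief M" and ?\<Gamma> = "\<lambda>_ :: nat. equilibrium_dist"
    have "revenue M ?B ?\<Gamma> j p' \<le> revenue M ?B ?\<Gamma> j p"
      if "j < 2" "p \<in> supp equilibrium_dist" "0 \<le> p'" for j p p'
    proof -
      have "1 - j < 2" "1 - j \<noteq> j" using \<open>j < 2\<close> by presburger+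
      from revenue_eq[OF this(1) \<open>j < 2\<close> this(2) eq.prob_space_axioms eq.events_eq_borel]
      show ?thesis using that equilibrium_dist_optimal by simp
    qed
    then show "market_equilibrium M {..<2} ?B ?\<Gamma>"
      by (auto simp: market_equilibrium_def price_dist_equilibrium_dist)
  qed simp
next
  fix G assume "\<exists>B \<Gamma>. market_equilibrium M {..<2} B \<Gamma> \<and> (\<forall>j\<in>{..<2}. \<Gamma> j = G)"
  then obtain B \<Gamma> where eq: "market_equilibrium M {..<2} B \<Gamma>" "\<And>j. j < 2 \<Longrightarrow> \<Gamma> j = G" by auto
  then have B: "\<And>j. j < 2 \<Longrightarrow> B j = learned_belief M j"
    by (auto simp: market_equilibrium_def)
  have "0 \<in> businesses M" by simp
  then have "price_dist (\<Gamma> 0)" using eq(1) unfolding market_equilibrium_def by blast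
  then have G: "price_dist G" using eq(2)[of 0] by simp
  \<comment> \<open>Undercutting is profitable only for a business that loses ties with positive
    probability, so \<open>j\<close> is chosen to be such a one.\<close>
  obtain i j :: nat where ij: "i < 2" "j < 2" "i \<noteq> j" "0 < tie i j"
  proof (cases "0 < tie 0 1")
    case True
    then show ?thesis by (intro that[of 0 1]) auto
  next
    case False
    then show ?thesis using tie_sum by (intro that[of 1 0]) auto
  qed
  have rev: "revenue M B \<Gamma> j p = profit (tie i j) G p" for p
    using G by (intro revenue_eq ij eq B) (auto simp: price_dist_def)
  show "G = equilibrium_dist"
  proof (rule equilibrium_dist_unique[OF G ij(4) tie_bounds(2)])
    fix p p' :: real assume "p \<in> supp G" "0 \<le> p'"
    then show "profit (tie i j) G p' \<le> profit (tie i j) G p"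
      using eq ij(2) unfolding rev[symmetric] by (auto simp: market_equilibrium_def)
  qed
qed

section \<open>Consumer welfare\<close>

abbreviation "price_law \<equiv> (\<Pi>\<^sub>M _\<in>{..<2::nat}. equilibrium_dist)"

lemma prob_space_price_law: "prob_space price_law"
  by (intro prob_space_PiM eq.prob_space_axioms)

lemma price_measurable: "i < 2 \<Longrightarrow> (\<lambda>P. P i) \<in> borel_measurable price_law"
  by (rule measurable_coordinate) auto

lemma AE_price_law: "AE P in price_law. P 0 \<in> {(1 - \<pi>) * q..q} \<and> P 1 \<in> {(1 - \<pi>) * q..q}"
  by (intro AE_conjI AE_PiM_component[where P="\<lambda>x. x \<in> {(1 - \<pi>) * q..q}"]
      eq.prob_space_axioms AE_equilibrium_dist) auto

lemma price_bounds_pos: "x \<in> {(1 - \<pi>) * q..q} \<Longrightarrow> 0 < x"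
  using mult_pos_pos[of "1 - \<pi>" q] pi Q by (simp del: power_one_over mult_pos_pos)

lemma integrable_price:
  assumes "h \<in> borel_measurable price_law"
    and bound: "\<And>P. P 0 \<in> {0..q} \<Longrightarrow> P 1 \<in> {0..q} \<Longrightarrow> \<bar>h P\<bar> \<le> (c :: real)"
  shows "integrable price_law h"
proof -
  interpret prob_space price_law by (rule prob_space_price_law)
  show ?thesis
  proof (rule integrable_const_bound)
    show "AE P in price_law. norm (h P) \<le> c"
      using AE_price_law
    proof (rule eventually_mono)
      fix P :: "nat \<Rightarrow> real"
      assume P: "P 0 \<in> {(1 - \<pi>) * q..q} \<and> P 1 \<in> {(1 - \<pi>) * q..q}"
      then have "0 < P 0" "0 < P 1" by (blast intro: price_bounds_pos)+
      with P have "P 0 \<in> {0..q}" "P 1 \<in> {0..q}" by auto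
      then show "norm (h P) \<le> c" unfolding real_norm_def by (rule bound)
    qed
  qed fact
qed

definition mean_price :: "nat \<Rightarrow> real" where
  "mean_price i = (\<integral>P. P i \<partial>price_law)"

definition mean_min_price :: real where
  "mean_min_price = (\<integral>P. min (P 0) (P 1) \<partial>price_law)"

lemma integrable_coordinate: "i < 2 \<Longrightarrow> integrable price_law (\<lambda>P. P i)"
  by (rule integrable_price[where c=q], erule price_measurable)
     (auto dest!: less_2_cases)

lemma integrable_min: "integrable price_law (\<lambda>P. min (P 0) (P 1))"
  using price_measurable[of 0] price_measurable[of 1]
  by (intro integrable_price[where c=q] borel_measurable_min) auto

text \<open>Integrating a business's payment over the competitor's price first makes the indifference
  condition applicable.\<close>

lemma expected_payment:
  assumes "i < 2" "j < 2" "i \<noteq> j" and A: "A \<in> {\<lambda>x. {..<x}, \<lambda>x. {..x}}"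
  shows "has_bochner_integral price_law (\<lambda>P. P i * (1 - \<pi> * indicator (A (P i)) (P j)))
    ((1 - \<pi>) * q)"
proof -
  have [simp]: "eq.prob UNIV = 1" using eq.prob_space by simp
  let ?\<phi> = "\<lambda>x y. x * (1 - \<pi> * indicator (A x) y) :: real"
  have m: "case_prod ?\<phi> \<in> borel_measurable (borel \<Otimes>\<^sub>M borel)"
  proof -
    have "{z :: real \<times> real. snd z \<in> A (fst z)} \<in> sets (borel \<Otimes>\<^sub>M borel)"
      using A borel_measurable_less[of snd "borel \<Otimes>\<^sub>M borel" "fst :: real \<times> real \<Rightarrow> real"]
        borel_measurable_le[of snd "borel \<Otimes>\<^sub>M borel" "fst :: real \<times> real \<Rightarrow> real"]
      by (auto simp: space_pair_measure)
    then have "(\<lambda>z :: real \<times> real. indicator {z. snd z \<in> A (fst z)} z :: real)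
        \<in> borel_measurable (borel \<Otimes>\<^sub>M borel)"
      by (rule borel_measurable_indicator)
    moreover have "case_prod ?\<phi> = (\<lambda>z. fst z * (1 - \<pi> * indicator {z. snd z \<in> A (fst z)} z))"
      by (auto simp: indicator_def fun_eq_iff)
    ultimately show ?thesis by simp
  qed
  have "(\<lambda>P. (P i, P j)) \<in> price_law \<rightarrow>\<^sub>M borel \<Otimes>\<^sub>M borel"
    by (intro measurable_Pair price_measurable assms)
  from measurable_compose[OF this m]
  have int: "integrable price_law (\<lambda>P. ?\<phi> (P i) (P j))"
  proof (intro integrable_price[where c=q])
    fix P :: "nat \<Rightarrow> real" assume P: "P 0 \<in> {0..q}" "P 1 \<in> {0..q}"
    then have x: "P i \<in> {0..q}" using less_2_cases[OF assms(1)] by auto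
    have "\<bar>1 - \<pi> * indicator (A (P i)) (P j)\<bar> \<le> 1" using pi by (auto simp: indicator_def)
    then have "\<bar>P i\<bar> * \<bar>1 - \<pi> * indicator (A (P i)) (P j)\<bar> \<le> q * 1"
      using x by (intro mult_mono) auto
    then show "\<bar>?\<phi> (P i) (P j)\<bar> \<le> q" by (simp add: abs_mult)
  qed auto
  have "(\<integral>P. ?\<phi> (P i) (P j) \<partial>price_law) = (\<integral>x. \<integral>y. ?\<phi> x y \<partial>equilibrium_dist \<partial>equilibrium_dist)"
    by (rule integral_PiM_two[OF eq.prob_space_axioms int _ assms(1-3)])
       (use m in \<open>simp cong: measurable_cong_sets sets_pair_measure_cong\<close>)
  also have "\<dots> = (\<integral>x. (1 - \<pi>) * q \<partial>equilibrium_dist)"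
  proof (rule integral_cong_AE)
    have inner: "(\<integral>y. ?\<phi> x y \<partial>equilibrium_dist) = x * (1 - \<pi> * eq.prob {..<x})" for x
    proof -
      \<comment> \<open>Prices have no atoms, so the strict and the weak comparison give the same
        probability.\<close>
      have "eq.prob {..x} = eq.prob ({..<x} \<union> {x})" by (rule arg_cong[where f=eq.prob]) auto
      also have "\<dots> = eq.prob {..<x}"
        by (subst eq.finite_measure_Union) (auto simp: equilibrium_dist_atomless)
      finally have "eq.prob (A x) = eq.prob {..<x}" using A by auto
      moreover have "A x \<in> sets borel" using A by auto
      ultimately show ?thesis by (simp add: eq.prob_space eq.emeasure_finite less_top[symmetric])
    qed
    show "AE x in equilibrium_dist. (\<integral>y. ?\<phi> x y \<partial>equilibrium_dist) = (1 - \<pi>) * q"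
      using AE_equilibrium_dist unfolding inner
      by (rule eventually_mono) (rule equilibrium_indifference)
    show "(\<lambda>x. \<integral>y. ?\<phi> x y \<partial>equilibrium_dist) \<in> borel_measurable equilibrium_dist"
      using m by (intro eq.borel_measurable_lebesgue_integral)
        (simp cong: measurable_cong_sets sets_pair_measure_cong)
  qed simp
  also have "\<dots> = (1 - \<pi>) * q" by (simp add: eq.prob_space)
  finally show ?thesis using int by (simp add: has_bochner_integral_iff)
qed

text \<open>The left side is what the consumer pays: \<open>P i\<close> if only \<open>i\<close>
  fits, the lower price if both do. Regrouped by recipient, each business gets its price except when
  it is beaten by a fitting competitor, and \<open>expected_payment\<close> applies. The strict and
  the weak comparison give a tie to business 0, so that the lower price is counted once.\<close>

lemma total_payment:
  "\<pi> * (1 - \<pi>) * (mean_price 0 + mean_price 1) + \<pi> * \<pi> * mean_min_price = 2 * \<pi> * (1 - \<pi>) * q"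
proof -
  have "has_bochner_integral price_law
      (\<lambda>P. \<pi> * (1 - \<pi>) * (P 0 + P 1) + \<pi> * \<pi> * min (P 0) (P 1))
      (\<pi> * (1 - \<pi>) * (mean_price 0 + mean_price 1) + \<pi> * \<pi> * mean_min_price)"
    unfolding mean_price_def mean_min_price_def
    by (intro has_bochner_integral_add has_bochner_integral_mult_right
        has_bochner_integral_integrable integrable_coordinate integrable_min) auto
  moreover have "has_bochner_integral price_law
      (\<lambda>P. \<pi> * (P 0 * (1 - \<pi> * indicator {..<P 0} (P 1))) +
        \<pi> * (P 1 * (1 - \<pi> * indicator {..P 1} (P 0))))
      (\<pi> * ((1 - \<pi>) * q) + \<pi> * ((1 - \<pi>) * q))"
    using expected_payment[of 0 1 "\<lambda>x. {..<x}"] expected_payment[of 1 0 "\<lambda>x. {..x}"]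
    by (intro has_bochner_integral_add has_bochner_integral_mult_right) auto
  moreover have "(\<lambda>P :: nat \<Rightarrow> real. \<pi> * (1 - \<pi>) * (P 0 + P 1) + \<pi> * \<pi> * min (P 0) (P 1)) =
      (\<lambda>P. \<pi> * (P 0 * (1 - \<pi> * indicator {..<P 0} (P 1))) +
        \<pi> * (P 1 * (1 - \<pi> * indicator {..P 1} (P 0))))"
    by (auto simp: fun_eq_iff indicator_def min_def algebra_simps simp del: power_one_over)
  ultimately show ?thesis
    by (metis (no_types, lifting) has_bochner_integral_eq mult.assoc mult_2)
qed

text \<open>Inspections are free, and equilibrium prices are below \<open>v * q\<close> almost
  surely, so a consumer buys whenever some business fits. Welfare is the expected surplus of these
  purchases minus the expected payment.\<close>

lemma consumer_welfare_eq:
  "consumer_welfare M {..<2} equilibrium_dist =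
    3 / 2 * q * (2 * \<pi> - \<pi> * \<pi>) - 2 * \<pi> * (1 - \<pi>) * q"
proof -
  let ?N = "price_law \<Otimes>\<^sub>M consumer_law M"
  define \<phi> where "\<phi> x = (of_bool (passes x) :: real)" for x
  define p where "p i z = fst z i" for i and z :: "(nat \<Rightarrow> real) \<times> consumer"
  define v where "v z = fst (snd z)" for z :: "(nat \<Rightarrow> real) \<times> consumer"
  define \<psi> where "\<psi> i z = \<phi> (fst (snd (snd z)) i)" for i and z :: "(nat \<Rightarrow> real) \<times> consumer"
  have p [measurable]: "p i \<in> borel_measurable ?N" if "i < 2" for i
    unfolding p_def[abs_def] by (rule measurable_compose[OF measurable_fst price_measurable[OF that]])
  have v [measurable]: "v \<in> borel_measurable ?N"
    unfolding v_def[abs_def] consumer_law_eq by measurable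
  have \<psi> [measurable]: "\<psi> i \<in> borel_measurable ?N" if "i < 2" for i
  proof -
    have "(\<lambda>f. \<phi> (f i)) \<in> borel_measurable (\<Pi>\<^sub>M _\<in>{..<2::nat}. screens)"
      by (rule measurable_compose[OF measurable_component_singleton[of i]]) (use that in auto)
    then show ?thesis unfolding \<psi>_def[abs_def] consumer_law_eq by measurable
  qed
  have "consumer_welfare M {..<2} equilibrium_dist =
    (\<integral>z. \<psi> 0 z * (1 - \<psi> 1 z) * max 0 (v z * q - p 0 z) +
      \<psi> 1 z * (1 - \<psi> 0 z) * max 0 (v z * q - p 1 z) +
      \<psi> 0 z * \<psi> 1 z * max 0 (max (v z * q - p 0 z) (v z * q - p 1 z)) \<partial>?N)"
    unfolding consumer_welfare_def
  proof (rule Bochner_Integration.integral_cong[OF refl], clarify)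
    fix P :: "nat \<Rightarrow> real" and w f t
    define s where "s = (\<lambda>j. index M (P j) (learned_belief M j) w)"
    have s: "s j = w * q - P j" for j by (simp add: s_def learned_belief_eq index_eq)
    define T where "T = transactions {..<2} s t (fits M f)"
    have sub: "T \<subseteq> {0, 1}" by (auto simp: T_def transactions_def inspections_def)
    have T0: "0 \<in> T \<longleftrightarrow> passes (f 0) \<and> 0 < s 0 \<and> \<not> (0 < s 1 \<and> precedes s t 1 0 \<and> passes (f 1))"
      and T1: "1 \<in> T \<longleftrightarrow> passes (f 1) \<and> 0 < s 1 \<and> \<not> (0 < s 0 \<and> precedes s t 0 1 \<and> passes (f 0))"
      unfolding T_def
      using transactions_two[of 1 0 s t "fits M f"] transactions_two[of 0 1 s t "fits M f"]
      by (auto simp: fits_eq)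
    have "(\<Sum>j\<in>T. w * q - P j) = (\<Sum>j\<in>{0, 1}. if j \<in> T then w * q - P j else 0)"
      using sub by (subst sum.inter_restrict[symmetric]) (auto simp: Int_absorb1)
    also have "\<dots> = (if 0 \<in> T then s 0 else 0) + (if 1 \<in> T then s 1 else 0)"
      by (simp add: s)
    \<comment> \<open>When both fit she gets the better offer; tied offers are worth the same, so
      the seeds \<open>t\<close> disappear.\<close>
    also have "\<dots> = \<phi> (f 0) * (1 - \<phi> (f 1)) * max 0 (s 0) + \<phi> (f 1) * (1 - \<phi> (f 0)) * max 0 (s 1) +
        \<phi> (f 0) * \<phi> (f 1) * max 0 (max (s 0) (s 1))"
      unfolding T0 T1 \<phi>_def by (auto simp: precedes_def)
    finally show "(let s = \<lambda>j. index M (P j) (learned_belief M j) w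
        in (\<Sum>j\<in>transactions {..<2} s t (fits M f). w * true_quality M j - P j) -
           search_cost M * real (card (inspections {..<2} s t (fits M f)))) =
      \<psi> 0 (P, w, f, t) * (1 - \<psi> 1 (P, w, f, t)) * max 0 (v (P, w, f, t) * q - p 0 (P, w, f, t)) +
      \<psi> 1 (P, w, f, t) * (1 - \<psi> 0 (P, w, f, t)) * max 0 (v (P, w, f, t) * q - p 1 (P, w, f, t)) +
      \<psi> 0 (P, w, f, t) * \<psi> 1 (P, w, f, t) *
        max 0 (max (v (P, w, f, t) * q - p 0 (P, w, f, t)) (v (P, w, f, t) * q - p 1 (P, w, f, t)))"
      unfolding Let_def s_def[symmetric] T_def[symmetric]
      by (simp add: true_quality s p_def v_def \<psi>_def)
  qed
  also have "\<dots> = (\<integral>z. q * (v z * (\<psi> 0 z + \<psi> 1 z - \<psi> 0 z * \<psi> 1 z)) -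
      (p 0 z * (\<psi> 0 z * (1 - \<psi> 1 z)) + p 1 z * (\<psi> 1 z * (1 - \<psi> 0 z)) +
       min (p 0 z) (p 1 z) * (\<psi> 0 z * \<psi> 1 z)) \<partial>?N)"
  proof (rule integral_cong_AE)
    have "AE z in ?N. p 0 z \<in> {(1 - \<pi>) * q..q} \<and> p 1 z \<in> {(1 - \<pi>) * q..q}"
      unfolding p_def by (rule AE_pair_fst[OF prob_space_consumer_law AE_price_law])
    moreover have "AE z in ?N. v z \<in> {1<..2}"
      unfolding v_def
    proof (rule AE_pair_snd)
      show "sigma_finite_measure (consumer_law M)"
        by (intro prob_space_imp_sigma_finite prob_space_consumer_law)
      show "AE c in consumer_law M. fst c \<in> {1<..2}"
        unfolding consumer_law_eq
        by (intro AE_pair_fst AE_value_dist prob_space_pair prob_space_PiM prob_space_screens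
            prob_space_uniform01)
    qed
    ultimately show "AE z in ?N. \<psi> 0 z * (1 - \<psi> 1 z) * max 0 (v z * q - p 0 z) +
      \<psi> 1 z * (1 - \<psi> 0 z) * max 0 (v z * q - p 1 z) +
      \<psi> 0 z * \<psi> 1 z * max 0 (max (v z * q - p 0 z) (v z * q - p 1 z)) =
      q * (v z * (\<psi> 0 z + \<psi> 1 z - \<psi> 0 z * \<psi> 1 z)) -
      (p 0 z * (\<psi> 0 z * (1 - \<psi> 1 z)) + p 1 z * (\<psi> 1 z * (1 - \<psi> 0 z)) +
       min (p 0 z) (p 1 z) * (\<psi> 0 z * \<psi> 1 z))"
    proof eventually_elim
      case (elim z)
      have "q < v z * q" using elim Q by simp
      moreover have "p 0 z \<le> q" "p 1 z \<le> q" using elim by auto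
      ultimately have "p 0 z \<le> v z * q" "p 1 z \<le> v z * q" by linarith+
      then show ?case by (auto simp: \<psi>_def \<phi>_def max_def min_def algebra_simps)
    qed
  qed measurable
  \<comment> \<open>Term by term from independence; the factors 1 belong to components that do not
    occur in a term, and \<open>3 / 2\<close> is the mean value.\<close>
  also have "\<dots> = q * (1 * (3 / 2 * ((\<pi> * 1 + 1 * \<pi> - \<pi> * \<pi>) * 1))) -
      (mean_price 0 * (1 * (\<pi> * (1 - \<pi>) * 1)) + mean_price 1 * (1 * (\<pi> * (1 - \<pi>) * 1)) +
       mean_min_price * (1 * (\<pi> * \<pi> * 1)))"
  proof (rule has_bochner_integral_integral_eq)
    have one: "has_bochner_integral (\<Pi>\<^sub>M _\<in>{..<2::nat}. uniform01) (\<lambda>_. 1) (1::real)"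
      by (intro has_bochner_integral_const prob_space_PiM prob_space_uniform01)
    have oneP: "has_bochner_integral price_law (\<lambda>_. 1) (1::real)"
      by (intro has_bochner_integral_const prob_space_price_law)
    have oneV: "has_bochner_integral (value_dist M) (\<lambda>_. 1) (1::real)"
      by (intro has_bochner_integral_const prob_space_value_dist)
    have \<phi>: "has_bochner_integral screens \<phi> \<pi>"
      unfolding \<phi>_def[abs_def] by (rule has_bochner_integral_passes)
    have oneS: "has_bochner_integral screens (\<lambda>_. 1) (1::real)"
      by (intro has_bochner_integral_const prob_space_screens)
    have \<phi>': "has_bochner_integral screens (\<lambda>x. 1 - \<phi> x) (1 - \<pi>)"
      by (intro has_bochner_integral_diff oneS \<phi>)
    note two = has_bochner_integral_PiM_two[OF prob_space_screens]
    note cons = has_bochner_integral_consumer[OF eq.prob_space_axioms]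
    have any: "has_bochner_integral (\<Pi>\<^sub>M _\<in>{..<2::nat}. screens)
        (\<lambda>f. \<phi> (f 0) * 1 + 1 * \<phi> (f 1) - \<phi> (f 0) * \<phi> (f 1)) (\<pi> * 1 + 1 * \<pi> - \<pi> * \<pi>)"
      by (intro has_bochner_integral_diff has_bochner_integral_add two[OF \<phi> oneS] two[OF oneS \<phi>]
          two[OF \<phi> \<phi>]) auto
    have mp: "has_bochner_integral price_law (\<lambda>P. P i) (mean_price i)" if "i < 2" for i
      unfolding mean_price_def by (intro has_bochner_integral_integrable integrable_coordinate that)
    have mm: "has_bochner_integral price_law (\<lambda>P. min (P 0) (P 1)) mean_min_price"
      unfolding mean_min_price_def by (intro has_bochner_integral_integrable integrable_min)
    have a: "has_bochner_integral ?N (\<lambda>z. v z * (\<psi> 0 z + \<psi> 1 z - \<psi> 0 z * \<psi> 1 z))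
        (1 * (3 / 2 * ((\<pi> * 1 + 1 * \<pi> - \<pi> * \<pi>) * 1)))"
      using cons[OF oneP mean_value any one] by (simp add: v_def \<psi>_def case_prod_unfold)
    have b: "has_bochner_integral ?N (\<lambda>z. p i z * (\<psi> i z * (1 - \<psi> j z)))
        (mean_price i * (1 * (\<pi> * (1 - \<pi>) * 1)))" if "i < 2" "j < 2" "i \<noteq> j" for i j
      using cons[OF mp[OF that(1)] oneV two[OF \<phi> \<phi>' that] one]
      by (simp add: p_def \<psi>_def case_prod_unfold)
    have c: "has_bochner_integral ?N (\<lambda>z. min (p 0 z) (p 1 z) * (\<psi> 0 z * \<psi> 1 z))
        (mean_min_price * (1 * (\<pi> * \<pi> * 1)))"
      using cons[OF mm oneV two[OF \<phi> \<phi>, of 0 1] one]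
      by (simp add: p_def \<psi>_def case_prod_unfold)
    show "has_bochner_integral ?N (\<lambda>z. q * (v z * (\<psi> 0 z + \<psi> 1 z - \<psi> 0 z * \<psi> 1 z)) -
      (p 0 z * (\<psi> 0 z * (1 - \<psi> 1 z)) + p 1 z * (\<psi> 1 z * (1 - \<psi> 0 z)) +
       min (p 0 z) (p 1 z) * (\<psi> 0 z * \<psi> 1 z)))
      (q * (1 * (3 / 2 * ((\<pi> * 1 + 1 * \<pi> - \<pi> * \<pi>) * 1))) -
      (mean_price 0 * (1 * (\<pi> * (1 - \<pi>) * 1)) + mean_price 1 * (1 * (\<pi> * (1 - \<pi>) * 1)) +
       mean_min_price * (1 * (\<pi> * \<pi> * 1))))"
      by (intro has_bochner_integral_diff has_bochner_integral_add has_bochner_integral_mult_right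
          a b c) auto
  qed
  also have "\<dots> = 3 / 2 * q * (2 * \<pi> - \<pi> * \<pi>) -
      (\<pi> * (1 - \<pi>) * (mean_price 0 + mean_price 1) + \<pi> * \<pi> * mean_min_price)"
    by (simp add: algebra_simps del: power_one_over)
  also have "\<dots> = 3 / 2 * q * (2 * \<pi> - \<pi> * \<pi>) - 2 * \<pi> * (1 - \<pi>) * q"
    by (simp only: total_payment)
  finally show ?thesis .
qed

text \<open>The learned set is the same on every path, so the outer expectation is that of a
  constant.\<close>

lemma canonical_welfare_eq:
  "canonical_welfare M = 3 / 2 * q * (2 * \<pi> - \<pi> * \<pi>) - 2 * \<pi> * (1 - \<pi>) * q"
proof -
  interpret prob_space "process M" by (rule prob_space_process)
  show ?thesis
    unfolding canonical_welfare_def learned_set_eq Let_def symmetric_price_dist_eq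
      consumer_welfare_eq
    by (simp add: prob_space del: power_one_over)
qed

end

theorem proposition7p16:
  shows "\<exists>M M' :: market.
    is_market M \<and> is_market M' \<and>
    learned_symmetric M \<and> learned_symmetric M' \<and>
    more_consumer_informative M' M \<and>
    no_business_lost M \<and> no_business_lost M' \<and>
    canonical_welfare M' < canonical_welfare M"
proof -
  interpret one: example 1 by unfold_locales simp
  interpret two: example 2 by unfold_locales simp
  have "more_consumer_informative (example_market 2) (example_market 1)"
    by (auto simp: more_consumer_informative_def example_market_def)
  \<comment> \<open>With \<open>\<pi> = q = 1/2\<close> the welfare is 5/16; with
    \<open>\<pi> = 1/4\<close> and \<open>q = 1\<close> it is 9/32.\<close>
  moreover have "canonical_welfare (example_market 2) < canonical_welfare (example_market 1)"
    unfolding one.canonical_welfare_eq two.canonical_welfare_eq by (simp add: power2_eq_square)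
  ultimately show ?thesis
    using one.is_market two.is_market one.learned_symmetric two.learned_symmetric
      one.no_business_lost two.no_business_lost
    by blast
qed

end
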